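(* For every $w\in S_n$, $$\mathfrak{G}_w(\mathbf{x})=\sum_{M\in\mathsf{MVPD}(w)}(-1)^{|\mathsf{wty}(M)|-\ell(w)}\,\mathsf{wt}_M(\mathbf{x}),\qquad \mathfrak{G}_w(\mathbf{x},\mathbf{y})=\sum_{M\in\mathsf{MVPD}(w)}(-1)^{|\mathsf{wty}(M)|-\ell(w)}\,\mathsf{wt}_M(\mathbf{x},\mathbf{y}).$$
   Context: Fix an integer $n\ge 1$. Cells $(i,j)$ of the $n\times n$ grid: row $i$ counted from the top, column $j$ counted from the left. Tiles. A cell is filled with one of: the blank tile; the H-tile (one strand joining the left and right edges); the J-tile (one strand joining the left and top edges); the R-tile (one strand joining the bottom and right edges, unmarked); the marked R-tile (an R-tile carrying a mark); the bump tile (two strands, one joining left and top, the other joining bottom and right); the cross tile (strands meeting all four edges). Neighbouring tiles must match along shared edges; pipes enter through the left boundary and exit through the top boundary (no strand meets the right or bottom boundary). Tracing pipes. The pipe entering from row $p$ is called pipe $p$. Pipes are traced from left to top, processing rows from bottom to top and cells in a row from left to right. At a cross tile where pipe $p$ enters from the left and pipe $q$ from the bottom: if $p$ and $q$ have not crossed before, they cross in this tile, $p$ exits right and $q$ exits top; otherwise they do not cross here, $p$ exits top and $q$ exits right. (Equivalently, pipe $\max(p,q)$ exits top.) Pipe dreams. A pipe dream (PD) is such a tiling of the $n\times n$ grid by cross, bump, J- and blank tiles with a pipe entering from every row and exiting from every column (so J-tiles are exactly at $i+j=n+1$, blanks at $i+j>n+1$, cross or bump tiles at $i+j\le n$). $\mathsf{PD}(w)$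 is the set of PDs such that for each $c$ the pipe exiting at the top of column $c$ is pipe $w^{-1}(c)$. $\mathsf{wty}(P)$ is the set of cells of the PD $P$ that are cross tiles. MVPDs. A vertical-less pipe dream is such a tiling of the $n\times n$ grid by blank, H-, cross, J-, R- and bump tiles. A marked vertical-less pipe dream (MVPD) is a vertical-less pipe dream in which some R-tiles are marked, where the pipe in a marked tile is required to pass through an H-tile in a row strictly below the marked tile. Its column-to-row code is the length-$n$ sequence whose $c$-th entry is $r$ if pipe $r$ exits at the top of column $c$, and $0$ if no pipe exits there. $\mathsf{wty}(M)$ is the set of cells of the MVPD $M$ that are H-tiles, cross tiles or marked R-tiles. The left-to-right maxima of a permutation $u$ are the numbers $u(i)$ with $u(j)<u(i)$ for all $j<i$. $\alpha'(w)$ is obtained from $(w^{-1}(1),\dots,w^{-1}(n))$ by replacing each left-to-right maximum of $w^{-1}$ by $0$. $\mathsf{MVPD}(w)$ is the set of MVPDs with column-to-row code $\alpha'(w)$. Weights. For $T$ a PD or an MVPD, $\mathsf{wt}_T(\mathbf{x})=\prod_{(i,j)\in\mathsf{wty}(T)}x_i$ and $\mathsf{wt}_T(\mathbf{x},\mathbf{y})=\prod_{(i,j)\in\mathsf{wty}(T)}(x_i+y_j-x_iy_j)$. Grothendieck polynomials are defined, with $\ell(w)$ the number of inversions of $w$, by $\mathfrak{G}_w(\mathbf{x})=\sum_{P\in\mathsf{PD}(w)}(-1)^{|\mathsf{wty}(P)|-\ell(w)}\mathsf{wt}_P(\mathbf{x})$ and the double Grothendieck polynomials by $\mathfrak{G}_w(\mathbf{x},\mathbf{y})=\sum_{P\in\mathsf{PD}(w)}(-1)^{|\mathsf{wty}(P)|-\ell(w)}\mathsf{wt}_P(\mathbf{x},\mathbf{y})$.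 *)

theory Defs
  imports "HOL-Library.Poly_Mapping" "HOL-Combinatorics.Permutations"
begin

section \<open>Tilings\<close>

datatype tile = Blank | HTile | JTile | RTile | MarkedRTile | Bump | Cross

fun has_left :: "tile \<Rightarrow> bool" where
  "has_left t \<longleftrightarrow> t \<in> {HTile, JTile, Bump, Cross}"

fun has_right :: "tile \<Rightarrow> bool" where
  "has_right t \<longleftrightarrow> t \<in> {HTile, RTile, MarkedRTile, Bump, Cross}"

fun has_top :: "tile \<Rightarrow> bool" where
  "has_top t \<longleftrightarrow> t \<in> {JTile, Bump, Cross}"

fun has_bottom :: "tile \<Rightarrow> bool" where
  "has_bottom t \<longleftrightarrow> t \<in> {RTile, MarkedRTile, Bump, Cross}"

type_synonym cell = "nat \<times> nat"

definition grid :: "nat \<Rightarrow> cell set" where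
  "grid n = {1..n} \<times> {1..n}"

type_synonym tiling = "cell \<Rightarrow> tile"

text \<open>Cells are written (row, column), both counted from 1, rows from the top. A tiling is blank
  off the grid, so that it is determined by its tiles on the grid; with this, the matching condition
  at the cells of column \<open>n\<close> and of row \<open>n\<close> says that no strand meets the right or the bottom
  boundary. (The left and top boundaries are unconstrained because the indices 0 are not used.)\<close>

definition is_tiling :: "nat \<Rightarrow> tiling \<Rightarrow> bool" where
  "is_tiling n T \<longleftrightarrow>
     (\<forall>c. c \<notin> grid n \<longrightarrow> T c = Blank) \<and>
     (\<forall>i\<in>{1..n}. \<forall>j\<in>{1..n}.
        (has_right (T (i, j)) \<longleftrightarrow> has_left (T (i, Suc j))) \<and>
        (has_bottom (T (i, j)) \<longleftrightarrow> has_top (T (Suc i, j))))"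


section \<open>Tracing pipes\<close>

text \<open>The state of the tracing procedure: the pipe entering each cell from the left, the pipe
  entering each cell from the bottom (0 if there is none), and the set of pairs of pipes that have
  crossed so far. The pipe leaving cell \<open>(1, j)\<close> through the top is recorded as entering \<open>(0, j)\<close>.\<close>

type_synonym trace_state = "(cell \<Rightarrow> nat) \<times> (cell \<Rightarrow> nat) \<times> nat set set"

definition trace_init :: "tiling \<Rightarrow> trace_state" where
  "trace_init T =
     ((\<lambda>(i, j). if j = 1 \<and> has_left (T (i, j)) then i else 0), (\<lambda>_. 0), {})"

definition trace_step :: "tiling \<Rightarrow> cell \<Rightarrow> trace_state \<Rightarrow> trace_state" where
  "trace_step T = (\<lambda>(i, j) (L, B, X).
     let p = L (i, j);
         q = B (i, j);
         r = (case T (i, j) of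
                Blank \<Rightarrow> 0 | HTile \<Rightarrow> p | JTile \<Rightarrow> 0 | RTile \<Rightarrow> q | MarkedRTile \<Rightarrow> q
              | Bump \<Rightarrow> q | Cross \<Rightarrow> (if {p, q} \<in> X then q else p));
         t = (case T (i, j) of
                Blank \<Rightarrow> 0 | HTile \<Rightarrow> 0 | JTile \<Rightarrow> p | RTile \<Rightarrow> 0 | MarkedRTile \<Rightarrow> 0
              | Bump \<Rightarrow> p | Cross \<Rightarrow> (if {p, q} \<in> X then p else q))
     in (L((i, Suc j) := r),
         B((i - 1, j) := t),
         (if T (i, j) = Cross then insert {p, q} X else X)))"

text \<open>Rows from bottom to top, cells of a row from left to right.\<close>

definition reading_order :: "nat \<Rightarrow> cell list" where
  "reading_order n = [(i, j). i \<leftarrow> rev [1..<Suc n], j \<leftarrow> [1..<Suc n]]"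

definition trace :: "nat \<Rightarrow> tiling \<Rightarrow> trace_state" where
  "trace n T = fold (trace_step T) (reading_order n) (trace_init T)"

definition left_pipe :: "nat \<Rightarrow> tiling \<Rightarrow> cell \<Rightarrow> nat" where
  "left_pipe n T = fst (trace n T)"

definition bottom_pipe :: "nat \<Rightarrow> tiling \<Rightarrow> cell \<Rightarrow> nat" where
  "bottom_pipe n T = fst (snd (trace n T))"

text \<open>The pipe leaving through the top of column \<open>c\<close>, or 0 if there is none; as a function of \<open>c\<close>
  this is the column-to-row code.\<close>

definition exit_pipe :: "nat \<Rightarrow> tiling \<Rightarrow> nat \<Rightarrow> nat" where
  "exit_pipe n T c = bottom_pipe n T (0, c)"


section \<open>Pipe dreams\<close>

definition is_pipe_dream :: "nat \<Rightarrow> tiling \<Rightarrow> bool" where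
  "is_pipe_dream n T \<longleftrightarrow>
     is_tiling n T \<and>
     (\<forall>c\<in>grid n. T c \<in> {Cross, Bump, JTile, Blank}) \<and>
     (\<forall>i\<in>{1..n}. has_left (T (i, 1))) \<and>
     (\<forall>j\<in>{1..n}. has_top (T (1, j)))"

definition PD :: "nat \<Rightarrow> (nat \<Rightarrow> nat) \<Rightarrow> tiling set" where
  "PD n w = {P. is_pipe_dream n P \<and> (\<forall>c\<in>{1..n}. exit_pipe n P c = inv w c)}"

definition wty_PD :: "nat \<Rightarrow> tiling \<Rightarrow> cell set" where
  "wty_PD n P = {c \<in> grid n. P c = Cross}"


section \<open>Marked vertical-less pipe dreams\<close>

definition is_vertical_less :: "nat \<Rightarrow> tiling \<Rightarrow> bool" where
  "is_vertical_less n T \<longleftrightarrow>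
     is_tiling n T \<and>
     (\<forall>c\<in>grid n. T c \<in> {Blank, HTile, Cross, JTile, RTile, Bump})"

fun unmark :: "tile \<Rightarrow> tile" where
  "unmark t = (if t = MarkedRTile then RTile else t)"

definition is_MVPD :: "nat \<Rightarrow> tiling \<Rightarrow> bool" where
  "is_MVPD n M \<longleftrightarrow>
     is_vertical_less n (unmark \<circ> M) \<and>
     (\<forall>(i, j)\<in>grid n. M (i, j) = MarkedRTile \<longrightarrow>
        (\<exists>(i', j')\<in>grid n. i' > i \<and> M (i', j') = HTile \<and>
           left_pipe n M (i', j') = bottom_pipe n M (i, j)))"

definition lr_maxima :: "nat \<Rightarrow> (nat \<Rightarrow> nat) \<Rightarrow> nat set" where
  "lr_maxima n u = {u i | i. i \<in> {1..n} \<and> (\<forall>j\<in>{1..<i}. u j < u i)}"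

definition alpha' :: "nat \<Rightarrow> (nat \<Rightarrow> nat) \<Rightarrow> nat \<Rightarrow> nat" where
  "alpha' n w c = (if inv w c \<in> lr_maxima n (inv w) then 0 else inv w c)"

definition MVPD :: "nat \<Rightarrow> (nat \<Rightarrow> nat) \<Rightarrow> tiling set" where
  "MVPD n w = {M. is_MVPD n M \<and> (\<forall>c\<in>{1..n}. exit_pipe n M c = alpha' n w c)}"

definition wty_MVPD :: "nat \<Rightarrow> tiling \<Rightarrow> cell set" where
  "wty_MVPD n M = {c \<in> grid n. M c \<in> {HTile, Cross, MarkedRTile}}"


section \<open>Weights and Grothendieck polynomials\<close>

text \<open>Integer polynomials in the indeterminates \<open>x\<^sub>i\<close>, \<open>y\<^sub>j\<close>, as finitely supported functions from
  monomials (exponent vectors) to coefficients.\<close>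

datatype indet = X nat | Y nat

type_synonym xy_poly = "(indet \<Rightarrow>\<^sub>0 nat) \<Rightarrow>\<^sub>0 int"

definition var :: "indet \<Rightarrow> xy_poly" where
  "var v = Poly_Mapping.single (Poly_Mapping.single v 1) 1"

definition wt_x :: "cell set \<Rightarrow> xy_poly" where
  "wt_x D = (\<Prod>(i, j)\<in>D. var (X i))"

definition wt_xy :: "cell set \<Rightarrow> xy_poly" where
  "wt_xy D = (\<Prod>(i, j)\<in>D. var (X i) + var (Y j) - var (X i) * var (Y j))"

definition perm_length :: "nat \<Rightarrow> (nat \<Rightarrow> nat) \<Rightarrow> nat" where
  "perm_length n w = card {(i, j). 1 \<le> i \<and> i < j \<and> j \<le> n \<and> w i > w j}"

text \<open>\<open>(-1)\<^sup>k\<close> for an arbitrary integer \<open>k\<close>, so that the exponents below are not truncated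
  differences.\<close>

definition neg_one_pow :: "int \<Rightarrow> xy_poly" where
  "neg_one_pow k = (- 1) ^ nat \<bar>k\<bar>"

definition groth :: "nat \<Rightarrow> (nat \<Rightarrow> nat) \<Rightarrow> xy_poly" where
  "groth n w = (\<Sum>P\<in>PD n w.
     neg_one_pow (int (card (wty_PD n P)) - int (perm_length n w)) * wt_x (wty_PD n P))"

definition double_groth :: "nat \<Rightarrow> (nat \<Rightarrow> nat) \<Rightarrow> xy_poly" where
  "double_groth n w = (\<Sum>P\<in>PD n w.
     neg_one_pow (int (card (wty_PD n P)) - int (perm_length n w)) * wt_xy (wty_PD n P))"

end

theory Submission
  imports Defs
begin

text \<open>Both sums are equal because there is a bijection \<open>PD(w) \<rightarrow> MVPD(w)\<close> that preserves the set of weight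
  cells, and it is defined cell by cell. The pipes that exit as left-to-right maxima of \<open>w\<inverse>\<close> are made
  invisible; the others, the set \<open>covered n (inv w)\<close>, stay visible. A cross tile, which meets two pipes,
  becomes a cross, an H-tile or a marked R-tile if both pipes, only the left one, or only the bottom
  one is visible; a bump tile becomes in the same way a bump, J-, R- or blank tile, and the J-tiles on
  the antidiagonal stay or become blank. So weight cells stay weight cells, and the mark on an
  R-tile records that the visible pipe shares a cross tile with an invisible one there.

  The key observation is that the smaller of two pipes that share a cross tile is always visible
  (\<open>covered_lower_visible\<close>). In a pipe dream two pipes have crossed exactly when they are inverted in
  the word read along the current boundary (\<open>pipe_dream_state\<close>); crossed pipes stay inverted, so at the
  exits the smaller one has a larger value to its left and is no left-to-right maximum. Hence

  \<^item> no cross tile disappears by becoming blank;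

  \<^item> at an H-tile the visible pipe comes from the left and is the smaller one, so the two pipes have
    not crossed yet, and the visible pipe does go straight on;

  \<^item> at a marked R-tile the visible pipe comes from below and is again the smaller one, so the
    two pipes have crossed before, and the visible pipe does turn right. Their first
    crossing (\<open>first_crossing\<close>) lies in a lower row and is an H-tile of the visible pipe, which is what
    a mark demands.

  So the trace of the new tiling is the trace of the pipe dream with the invisible pipes erased
  (\<open>masked_everywhere\<close>).

  Conversely, given an MVPD, the tiles of a pipe dream are forced; the pipes that enter the MVPD
  play the role of the visible ones. An induction along the reading order shows that its trace is again
  the masked trace and that the smaller pipe of each cross tile is visible (\<open>reveal_masked\<close>). At a marked
  R-tile this is where the condition on marks enters: the H-tile below yields a larger invisible pipe
  to the left of the marked one, and since two invisible pipes never cross, the invisible pipe that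
  comes from the left is at least as large. Finally the invisible pipes exit in increasing order,
  as the left-to-right maxima of \<open>w\<inverse>\<close> do, so the visible exits determine all exits
  (\<open>increasing_filling_unique\<close>) and the pipe dream lies in \<open>PD(w)\<close>.\<close>

declare unmark.simps [simp del] has_left.simps [simp del] has_right.simps [simp del]
  has_top.simps [simp del] has_bottom.simps [simp del]

lemmas edge_simps = has_left.simps has_right.simps has_top.simps has_bottom.simps

text \<open>Cells are kept as single variables in quantifiers over the grid.\<close>

declare split_paired_All [simp del] split_paired_Ex [simp del]

lemma has_edge_unmark [simp]:
  "has_left (unmark t) = has_left t" "has_right (unmark t) = has_right t"
  "has_top (unmark t) = has_top t" "has_bottom (unmark t) = has_bottom t"
  by (cases t; simp add: unmark.simps edge_simps)+

lemma tiling_match: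
  assumes "is_tiling n T" "(i, j) \<in> grid n"
  shows "has_right (T (i, j)) \<longleftrightarrow> has_left (T (i, Suc j))"
    and "has_bottom (T (i, j)) \<longleftrightarrow> has_top (T (Suc i, j))"
  using assms unfolding is_tiling_def grid_def by auto

lemma tiling_outside: "is_tiling n T \<Longrightarrow> c \<notin> grid n \<Longrightarrow> T c = Blank"
  unfolding is_tiling_def by blast

section \<open>The trace as a system of local equations\<close>

definition precedes :: "cell \<Rightarrow> cell \<Rightarrow> bool" (infix "\<prec>" 50) where
  "d \<prec> c \<longleftrightarrow> fst c < fst d \<or> fst d = fst c \<and> snd d < snd c"

lemma precedes_asym: "c \<prec> d \<Longrightarrow> \<not> d \<prec> c"
  by (auto simp: precedes_def)

lemma precedes_trans: "c \<prec> d \<Longrightarrow> d \<prec> e \<Longrightarrow> c \<prec> e"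
  by (auto simp: precedes_def)

text \<open>The crossing history read off the completed trace. This agrees with the set carried
  by the tracing procedure when it reaches \<open>c\<close>, because the pipes recorded at a cell already visited
  are never overwritten.\<close>

definition crossed :: "nat \<Rightarrow> tiling \<Rightarrow> cell \<Rightarrow> nat set set" where
  "crossed n T c = {{left_pipe n T d, bottom_pipe n T d} | d. d \<in> grid n \<and> d \<prec> c \<and> T d = Cross}"

lemma cell_induct [case_names step]:
  assumes "\<And>c. (\<And>d. d \<in> grid n \<Longrightarrow> d \<prec> c \<Longrightarrow> P d) \<Longrightarrow> P c"
  shows "P c"
proof -
  have "wf (inv_image (less_than <*lex*> less_than) (\<lambda>c::cell. (n - fst c, snd c)))"
    by auto
  then show ?thesis
  proof (induction c rule: wf_induct_rule)
    case (less c)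
    show ?case
    proof (rule assms)
      fix d assume "d \<in> grid n" "d \<prec> c"
      then show "P d" by (intro less) (auto simp: precedes_def grid_def)
    qed
  qed
qed

text \<open>Induction along the positions between consecutive tracing steps; position \<open>Suc n\<close> in a row is the
  one after its last cell, and nothing happens between it and the start of the row above.\<close>

lemma reading_induct [consumes 2, case_names first cell row]:
  assumes "i \<in> {1..n}" "j \<in> {1..Suc n}"
    and first: "P n 1"
    and cell: "\<And>i j. i \<in> {1..n} \<Longrightarrow> j \<in> {1..n} \<Longrightarrow> P i j \<Longrightarrow> P i (Suc j)"
    and row: "\<And>i. i \<in> {1..<n} \<Longrightarrow> P (Suc i) (Suc n) \<Longrightarrow> P i 1"
  shows "P i j"
proof -
  have across: "P i j" if "P i 1" "i \<in> {1..n}" "1 \<le> j" "j \<le> Suc n" for i j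
    using that(3,4)
  proof (induction j rule: dec_induct)
    case base then show ?case using that by simp
  next
    case (step j) then show ?case using cell[of i j] that(2) by simp
  qed
  have start: "1 \<le> i \<longrightarrow> P i 1" if "i \<le> n" for i
    using that
  proof (induction i rule: inc_induct)
    case base then show ?case using first by simp
  next
    case (step i)
    then have "P (Suc i) (Suc n)" using across[of "Suc i" "Suc n"] by simp
    then show ?case using row[of i] step.hyps by simp
  qed
  show ?thesis
    by (rule across) (use start[of i] assms(1,2) in simp_all)
qed

lemma set_reading_order: "set (reading_order n) = grid n"
  by (auto simp: reading_order_def grid_def image_iff simp del: upt_Suc)

lemma sorted_reading_order: "sorted_wrt (\<prec>) (reading_order n)"
proof -
  have row: "sorted_wrt (\<prec>) (map (Pair i) [1..<Suc n])" for i
    by (simp add: sorted_wrt_map precedes_def sorted_wrt_upt del: upt_Suc)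
  have rows: "sorted_wrt (\<prec>) (concat (map (\<lambda>i. map (Pair i) [1..<Suc n]) is))"
    if "sorted_wrt (>) is" for "is"
    using that
  proof (induction "is")
    case (Cons i "is")
    then show ?case using row[of i]
      by (auto simp: sorted_wrt_append precedes_def[where c = "(_, _)"] simp del: upt_Suc)
  qed simp
  have "sorted_wrt (>) (rev [1..<Suc n])"
    by (simp add: sorted_wrt_rev sorted_wrt_upt del: upt_Suc)
  from rows[OF this] show ?thesis by (simp add: reading_order_def del: upt_Suc)
qed

text \<open>A tracing step writes only the pipes on the right and on the top edge of its cell. Together
  with the order of the cells this shows that the value read at a step is the final one, so that the
  loop can be replaced by equations between final values.\<close>

lemma trace_step_frame:
  assumes "snd e \<noteq> Suc (snd d) \<or> fst e \<noteq> fst d"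
  shows "fst (trace_step T d st) e = fst st e"
  using assms by (cases d; cases st; cases e) (auto simp: trace_step_def Let_def)

lemma trace_step_frame_bottom:
  assumes "snd e \<noteq> snd d \<or> fst e \<noteq> fst d - 1"
  shows "fst (snd (trace_step T d st)) e = fst (snd st) e"
  using assms by (cases d; cases st; cases e) (auto simp: trace_step_def Let_def)

lemma fold_trace_frame:
  assumes "\<And>d. d \<in> set ds \<Longrightarrow> snd e \<noteq> Suc (snd d) \<or> fst e \<noteq> fst d"
  shows "fst (fold (trace_step T) ds st) e = fst st e"
  using assms by (induction ds arbitrary: st) (simp_all add: trace_step_frame)

lemma fold_trace_frame_bottom:
  assumes "\<And>d. d \<in> set ds \<Longrightarrow> snd e \<noteq> snd d \<or> fst e \<noteq> fst d - 1"
  shows "fst (snd (fold (trace_step T) ds st)) e = fst (snd st) e"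
  using assms by (induction ds arbitrary: st) (simp_all add: trace_step_frame_bottom)

lemma trace_read_final:
  fixes T :: tiling
  assumes ro: "reading_order n = cs @ c # ds"
  defines "st \<equiv> fold (trace_step T) cs (trace_init T)"
  shows "fst st c = left_pipe n T c" "fst (snd st) c = bottom_pipe n T c"
proof -
  have later: "d \<in> grid n \<and> (d = c \<or> c \<prec> d)" if "d \<in> set (c # ds)" for d
    using that sorted_reading_order[of n] set_reading_order[of n] unfolding ro
    by (auto simp: sorted_wrt_append)
  have fin: "trace n T = fold (trace_step T) (c # ds) st"
    unfolding trace_def ro st_def by simp
  show "fst st c = left_pipe n T c"
    unfolding left_pipe_def fin
  proof (rule fold_trace_frame[symmetric])
    fix d assume "d \<in> set (c # ds)"
    from later[OF this] show "snd c \<noteq> Suc (snd d) \<or> fst c \<noteq> fst d" by (auto simp: precedes_def)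
  qed
  show "fst (snd st) c = bottom_pipe n T c"
    unfolding bottom_pipe_def fin
  proof (rule fold_trace_frame_bottom[symmetric])
    fix d assume "d \<in> set (c # ds)"
    from later[OF this] show "snd c \<noteq> snd d \<or> fst c \<noteq> fst d - 1" by (auto simp: precedes_def grid_def)
  qed
qed

lemma trace_crossed_pairs:
  assumes "reading_order n = cs @ ds"
  shows "snd (snd (fold (trace_step T) cs (trace_init T))) =
    {{left_pipe n T d, bottom_pipe n T d} | d. d \<in> set cs \<and> T d = Cross}"
  using assms
proof (induction cs arbitrary: ds rule: rev_induct)
  case Nil
  then show ?case by (simp add: trace_init_def)
next
  case (snoc c cs)
  let ?st = "fold (trace_step T) cs (trace_init T)"
  have ro: "reading_order n = cs @ c # ds" using snoc.prems by simp
  have "snd (snd (trace_step T c ?st)) =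
      (if T c = Cross then insert {fst ?st c, fst (snd ?st) c} (snd (snd ?st)) else snd (snd ?st))"
    by (cases c; cases ?st) (auto simp: trace_step_def Let_def)
  then show ?case
    using snoc.IH[OF ro] trace_read_final[OF ro, of T] by auto
qed

text \<open>The two local rules of tracing: the pipe leaving through the right or top edge of a tile with pipe
  \<open>p\<close> from the left and \<open>q\<close> from the bottom, where \<open>x\<close> tells whether they have crossed before.\<close>

definition right_exit :: "tile \<Rightarrow> nat \<Rightarrow> nat \<Rightarrow> bool \<Rightarrow> nat" where
  "right_exit t p q x = (case t of
     Blank \<Rightarrow> 0 | HTile \<Rightarrow> p | JTile \<Rightarrow> 0 | RTile \<Rightarrow> q | MarkedRTile \<Rightarrow> q
   | Bump \<Rightarrow> q | Cross \<Rightarrow> (if x then q else p))"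

definition top_exit :: "tile \<Rightarrow> nat \<Rightarrow> nat \<Rightarrow> bool \<Rightarrow> nat" where
  "top_exit t p q x = (case t of
     Blank \<Rightarrow> 0 | HTile \<Rightarrow> 0 | JTile \<Rightarrow> p | RTile \<Rightarrow> 0 | MarkedRTile \<Rightarrow> 0
   | Bump \<Rightarrow> p | Cross \<Rightarrow> (if x then p else q))"

lemma trace_equations:
  fixes T :: tiling
  assumes "(i, j) \<in> grid n"
  defines "p \<equiv> left_pipe n T (i, j)" and "q \<equiv> bottom_pipe n T (i, j)"
  shows left_pipe_Suc: "left_pipe n T (i, Suc j) = right_exit (T (i, j)) p q ({p, q} \<in> crossed n T (i, j))"
    and bottom_pipe_pred: "bottom_pipe n T (i - 1, j) = top_exit (T (i, j)) p q ({p, q} \<in> crossed n T (i, j))"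
proof -
  obtain cs ds where ro: "reading_order n = cs @ (i, j) # ds"
    using assms(1) set_reading_order split_list by metis
  let ?st = "fold (trace_step T) cs (trace_init T)"
  have sorted: "sorted_wrt (\<prec>) (cs @ (i, j) # ds)" and set: "set (cs @ (i, j) # ds) = grid n"
    using sorted_reading_order[of n] set_reading_order[of n] unfolding ro by auto
  have before: "d \<in> set cs \<longleftrightarrow> d \<in> grid n \<and> d \<prec> (i, j)" for d
  proof -
    have "d \<in> grid n \<longleftrightarrow> d \<in> set cs \<or> d = (i, j) \<or> d \<in> set ds" using set by auto
    then show ?thesis using sorted by (auto simp: sorted_wrt_append dest: precedes_asym)
  qed
  have C: "snd (snd ?st) = crossed n T (i, j)"
    unfolding trace_crossed_pairs[OF ro] crossed_def using before by auto
  have L: "fst ?st (i, j) = p" and B: "fst (snd ?st) (i, j) = q"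
    using trace_read_final[OF ro, of T] unfolding p_def q_def by auto
  have later: "d \<in> grid n \<and> (i, j) \<prec> d" if "d \<in> set ds" for d
    using that sorted set by (auto simp: sorted_wrt_append)
  have fin: "trace n T = fold (trace_step T) ds (trace_step T (i, j) ?st)"
    unfolding trace_def ro by simp
  have "left_pipe n T (i, Suc j) = fst (trace_step T (i, j) ?st) (i, Suc j)"
    unfolding left_pipe_def fin
  proof (rule fold_trace_frame)
    fix d assume "d \<in> set ds"
    from later[OF this] show "snd (i, Suc j) \<noteq> Suc (snd d) \<or> fst (i, Suc j) \<noteq> fst d"
      by (auto simp: precedes_def)
  qed
  also have "\<dots> = right_exit (T (i, j)) p q ({p, q} \<in> crossed n T (i, j))"
    unfolding C[symmetric] L[symmetric] B[symmetric]
    by (cases ?st) (simp add: trace_step_def Let_def right_exit_def)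
  finally show "left_pipe n T (i, Suc j) = right_exit (T (i, j)) p q ({p, q} \<in> crossed n T (i, j))" .
  have "bottom_pipe n T (i - 1, j) = fst (snd (trace_step T (i, j) ?st)) (i - 1, j)"
    unfolding bottom_pipe_def fin
  proof (rule fold_trace_frame_bottom)
    fix d assume "d \<in> set ds"
    from later[OF this] assms(1) show "snd (i - 1, j) \<noteq> snd d \<or> fst (i - 1, j) \<noteq> fst d - 1"
      by (auto simp: precedes_def grid_def)
  qed
  also have "\<dots> = top_exit (T (i, j)) p q ({p, q} \<in> crossed n T (i, j))"
    unfolding C[symmetric] L[symmetric] B[symmetric]
    by (cases ?st) (simp add: trace_step_def Let_def top_exit_def)
  finally show "bottom_pipe n T (i - 1, j) = top_exit (T (i, j)) p q ({p, q} \<in> crossed n T (i, j))" .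
qed

lemma left_pipe_first_column: "left_pipe n T (i, 1) = (if has_left (T (i, 1)) then i else 0)"
proof -
  have "left_pipe n T (i, 1) = fst (trace_init T) (i, 1)"
    unfolding left_pipe_def trace_def
    by (rule fold_trace_frame) (auto simp: set_reading_order grid_def)
  then show ?thesis by (simp add: trace_init_def)
qed

lemma bottom_pipe_last_row: "bottom_pipe n T (n, j) = 0"
proof -
  have "bottom_pipe n T (n, j) = fst (snd (trace_init T)) (n, j)"
    unfolding bottom_pipe_def trace_def
    by (rule fold_trace_frame_bottom) (auto simp: set_reading_order grid_def)
  then show ?thesis by (simp add: trace_init_def)
qed

lemma crossed_Suc:
  assumes "(i, j) \<in> grid n"
  shows "crossed n T (i, Suc j) = (if T (i, j) = Cross
    then insert {left_pipe n T (i, j), bottom_pipe n T (i, j)} (crossed n T (i, j))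
    else crossed n T (i, j))"
proof -
  have "d \<prec> (i, Suc j) \<longleftrightarrow> d \<prec> (i, j) \<or> d = (i, j)" for d
    by (cases d) (auto simp: precedes_def)
  then show ?thesis unfolding crossed_def using assms by auto
qed

lemma crossed_next_row: "crossed n T (i, 1) = crossed n T (Suc i, Suc n)"
proof -
  have "d \<prec> (i, 1) \<longleftrightarrow> d \<prec> (Suc i, Suc n)" if "d \<in> grid n" for d
    using that by (auto simp: precedes_def grid_def)
  then show ?thesis unfolding crossed_def by blast
qed

lemma crossed_first: "crossed n T (n, 1) = {}"
  by (auto simp: crossed_def precedes_def grid_def)

text \<open>The value 0 means exactly that no strand meets the edge, by induction along the reading order:
  a tile passes pipes on to the edges that its strands reach, and neighbouring tiles match.\<close>

lemma pipe_iff_strand: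
  assumes "is_tiling n (unmark \<circ> T)" "c \<in> grid n"
  shows "(left_pipe n T c \<noteq> 0 \<longleftrightarrow> has_left (T c)) \<and> (bottom_pipe n T c \<noteq> 0 \<longleftrightarrow> has_bottom (T c))"
  using assms(2)
proof (induction c rule: cell_induct[of n])
  case (step c)
  obtain i j where c: "c = (i, j)" and ij: "i \<in> {1..n}" "j \<in> {1..n}"
    using step.prems by (auto simp: grid_def)
  have match: "has_right (T (i, j)) \<longleftrightarrow> has_left (T (i, Suc j))"
    "has_bottom (T (i, j)) \<longleftrightarrow> has_top (T (Suc i, j))" if "(i, j) \<in> grid n" for i j
    using tiling_match[OF assms(1) that] by simp_all
  have outside: "T c = Blank" if "c \<notin> grid n" for c
    using tiling_outside[OF assms(1) that] by (cases "T c") (auto simp: unmark.simps)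
  have right: "right_exit t p q x \<noteq> 0 \<longleftrightarrow> has_right t" and top: "top_exit t p q x \<noteq> 0 \<longleftrightarrow> has_top t"
    if "p \<noteq> 0 \<longleftrightarrow> has_left t" "q \<noteq> 0 \<longleftrightarrow> has_bottom t" for t p q x
    using that by (cases t; auto simp: right_exit_def top_exit_def edge_simps)+
  have "left_pipe n T (i, j) \<noteq> 0 \<longleftrightarrow> has_left (T (i, j))"
  proof (cases "j = 1")
    case True
    then show ?thesis using ij left_pipe_first_column[of n T i] by simp
  next
    case False
    then obtain k where k: "j = Suc k" "(i, k) \<in> grid n" "k \<in> {1..n}"
      using ij by (cases j) (auto simp: grid_def)
    have "(i, k) \<prec> c" using k c by (simp add: precedes_def)
    then show ?thesis
      using step.IH[OF k(2)] k left_pipe_Suc[OF k(2), of T] right match(1)[OF k(2)] by simp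
  qed
  moreover have "bottom_pipe n T (i, j) \<noteq> 0 \<longleftrightarrow> has_bottom (T (i, j))"
  proof (cases "i = n")
    case True
    then show ?thesis using bottom_pipe_last_row[of n T j] match(2)[of i j] ij outside[of "(Suc n, j)"]
      by (simp add: grid_def edge_simps)
  next
    case False
    then have k: "(Suc i, j) \<in> grid n" using ij by (auto simp: grid_def)
    have "(Suc i, j) \<prec> c" using c by (simp add: precedes_def)
    then show ?thesis
      using step.IH[OF k] k bottom_pipe_pred[OF k, of T] top match(2)[of i j] ij
      by (simp add: grid_def)
  qed
  ultimately show ?case using c by simp
qed

section \<open>Pipe dreams\<close>

text \<open>In each of the tiles of a pipe dream the strands on the left and top edges occur
  together, and so do those on the right and bottom edges. So matching carries a strand at the left of
  \<open>(i, Suc j)\<close> to one at the left of \<open>(Suc i, j)\<close>, and the shape of a pipe dream is constant along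
  antidiagonals.\<close>

lemma pipe_dream_iff:
  "is_pipe_dream n P \<longleftrightarrow> (\<forall>i j.
     (if (i, j) \<notin> grid n \<or> n + 1 < i + j then P (i, j) = Blank
      else if i + j = n + 1 then P (i, j) = JTile else P (i, j) \<in> {Bump, Cross}))" (is "?L \<longleftrightarrow> ?R")
proof
  assume ?L
  then have tiling: "is_tiling n P" and tiles: "\<And>c. c \<in> grid n \<Longrightarrow> P c \<in> {Cross, Bump, JTile, Blank}"
    and left: "\<And>i. i \<in> {1..n} \<Longrightarrow> has_left (P (i, 1))"
    unfolding is_pipe_dream_def by auto
  note outside = tiling_outside[OF tiling]
  have all: "P c \<in> {Cross, Bump, JTile, Blank}" for c using tiles outside by blast
  note match = tiling_match[OF tiling]
  have diag: "has_left (P (i, Suc j)) \<longleftrightarrow> has_left (P (Suc i, j))" if "(i, j) \<in> grid n" for i j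
    using match[OF that] all[of "(i, j)"] all[of "(Suc i, j)"] by (auto simp: edge_simps)
  have left_iff: "has_left (P (i, Suc j)) \<longleftrightarrow> i + Suc j \<le> n + 1" if "i \<in> {1..n}" "Suc j \<le> n" for i j
    using that
  proof (induction j arbitrary: i)
    case 0
    then show ?case using left by auto
  next
    case (Suc j)
    then have "(i, Suc j) \<in> grid n" by (auto simp: grid_def)
    note d = diag[OF this]
    show ?case
    proof (cases "i = n")
      case True
      then show ?thesis using d outside[of "(Suc n, Suc j)"] by (simp add: grid_def edge_simps)
    next
      case False
      then show ?thesis using d Suc.IH[of "Suc i"] Suc.prems by auto
    qed
  qed
  have left_iff': "has_left (P (i, j)) \<longleftrightarrow> i + j \<le> n + 1" if "(i, j) \<in> grid n" for i j
    using left_iff[of i "j - 1"] that by (auto simp: grid_def)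
  have right_iff: "has_right (P (i, j)) \<longleftrightarrow> i + j \<le> n" if "(i, j) \<in> grid n" for i j
  proof (cases "j = n")
    case True
    then show ?thesis using match(1)[OF that] outside[of "(i, Suc n)"] that by (simp add: grid_def edge_simps)
  next
    case False
    then show ?thesis using match(1)[OF that] left_iff'[of i "Suc j"] that by (auto simp: grid_def)
  qed
  show ?R
  proof (intro allI)
    fix i j
    show "if (i, j) \<notin> grid n \<or> n + 1 < i + j then P (i, j) = Blank
      else if i + j = n + 1 then P (i, j) = JTile else P (i, j) \<in> {Bump, Cross}"
    proof (cases "(i, j) \<in> grid n")
      case True
      then show ?thesis using left_iff'[OF True] right_iff[OF True] tiles[OF True] by (auto simp: edge_simps)
    next
      case False
      then show ?thesis using outside by auto
    qed
  qed
next
  assume R: ?R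
  have blank: "P (i, j) = Blank" if "(i, j) \<notin> grid n \<or> n + 1 < i + j" for i j
    using R that by (auto simp: split: if_splits)
  have J: "P (i, j) = JTile" if "(i, j) \<in> grid n" "i + j = n + 1" for i j
    using R[rule_format, of i j] that by auto
  have BC: "P (i, j) \<in> {Bump, Cross}" if "(i, j) \<in> grid n" "i + j \<le> n" for i j
    using R[rule_format, of i j] that by auto
  have left: "has_left (P (i, j)) \<longleftrightarrow> (i, j) \<in> grid n \<and> i + j \<le> n + 1"
    and top: "has_top (P (i, j)) \<longleftrightarrow> (i, j) \<in> grid n \<and> i + j \<le> n + 1"
    and right: "has_right (P (i, j)) \<longleftrightarrow> (i, j) \<in> grid n \<and> i + j \<le> n"
    and bottom: "has_bottom (P (i, j)) \<longleftrightarrow> (i, j) \<in> grid n \<and> i + j \<le> n" for i j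
    using blank[of i j] J[of i j] BC[of i j]
    by (cases "(i, j) \<notin> grid n \<or> n + 1 < i + j"; cases "i + j = n + 1"; auto simp: edge_simps)+
  have "P c \<in> {Cross, Bump, JTile, Blank}" for c
    using R[rule_format, of "fst c" "snd c"] by (auto split: if_splits)
  then show ?L
    unfolding is_pipe_dream_def is_tiling_def left top right bottom
    using blank by (auto simp: grid_def split_paired_All)
qed


text \<open>The pipes met along the staircase boundary between the cells already traced and the rest, just before
  cell \<open>(i, j)\<close> is processed: the tops of the first \<open>j - 1\<close> cells of row \<open>i\<close>, the left edge of the
  current cell, and the bottoms of the remaining cells. Processing \<open>(i, j)\<close> affects only the
  positions \<open>j\<close> and \<open>Suc j\<close>.\<close>

definition word :: "nat \<Rightarrow> tiling \<Rightarrow> nat \<Rightarrow> nat \<Rightarrow> nat \<Rightarrow> nat" where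
  "word n T i j k = (if k < j then bottom_pipe n T (i - 1, k)
     else if k = j then left_pipe n T (i, j) else bottom_pipe n T (i, k - 1))"

text \<open>The crossing history \<open>C\<close> consists of the inversions of the word \<open>a\<close>. The condition that all
  recorded pairs lie in \<open>S\<close> ensures that a pipe entering later has not crossed anything.\<close>

definition inversion_state :: "(nat \<Rightarrow> nat) \<Rightarrow> nat set set \<Rightarrow> nat \<Rightarrow> nat set \<Rightarrow> bool" where
  "inversion_state a C m S \<longleftrightarrow> bij_betw a {1..m} S \<and> (\<forall>U\<in>C. U \<subseteq> S) \<and>
     (\<forall>k l. 1 \<le> k \<longrightarrow> k < l \<longrightarrow> l \<le> m \<longrightarrow> ({a k, a l} \<in> C \<longleftrightarrow> a l < a k))"

lemma inversion_state_cong: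
  assumes "inversion_state a C m S" "\<And>k. k \<in> {1..m} \<Longrightarrow> b k = a k"
  shows "inversion_state b C m S"
proof -
  have "bij_betw b {1..m} S \<longleftrightarrow> bij_betw a {1..m} S"
    using assms(2) by (intro bij_betw_cong) auto
  moreover have "{b k, b l} \<in> C \<longleftrightarrow> b l < b k" if "1 \<le> k" "k < l" "l \<le> m" for k l
    using assms(1) assms(2)[of k] assms(2)[of l] that unfolding inversion_state_def by simp
  ultimately show ?thesis using assms(1) unfolding inversion_state_def by blast
qed

lemma inversion_stateI:
  assumes "bij_betw a {1..m} S" "\<And>U. U \<in> C \<Longrightarrow> U \<subseteq> S"
    "\<And>k l. 1 \<le> k \<Longrightarrow> k < l \<Longrightarrow> l \<le> m \<Longrightarrow> {a k, a l} \<in> C \<longleftrightarrow> a l < a k"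
  shows "inversion_state a C m S"
  unfolding inversion_state_def using assms by blast

lemma inversion_stateD:
  assumes "inversion_state a C m S"
  shows "bij_betw a {1..m} S" "U \<in> C \<Longrightarrow> U \<subseteq> S"
    "1 \<le> k \<Longrightarrow> k < l \<Longrightarrow> l \<le> m \<Longrightarrow> {a k, a l} \<in> C \<longleftrightarrow> a l < a k"
  using assms unfolding inversion_state_def by blast+

text \<open>Exchanging two neighbours in increasing order creates exactly one inversion, namely the pair that crosses.\<close>

lemma inversion_state_swap:
  assumes st: "inversion_state a C m S" and j: "1 \<le> j" "j < m" and less: "a j < a (Suc j)"
  shows "inversion_state (a \<circ> Transposition.transpose j (Suc j)) (insert {a j, a (Suc j)} C) m S"
proof -
  let ?s = "Transposition.transpose j (Suc j)"
  note bij = inversion_stateD(1)[OF st] and sub = inversion_stateD(2)[OF st]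
    and inv = inversion_stateD(3)[OF st]
  have inj: "a k = a l \<longleftrightarrow> k = l" if "k \<in> {1..m}" "l \<in> {1..m}" for k l
    using inj_on_eq_iff[OF bij_betw_imp_inj_on[OF bij]] that by blast
  have "?s permutes {1..m}" using j by (intro permutes_swap_id) auto
  then have bij': "bij_betw (a \<circ> ?s) {1..m} S"
    by (intro bij_betw_trans[OF _ bij]) (rule permutes_imp_bij)
  have aS: "a j \<in> S" "a (Suc j) \<in> S" using bij j by (auto simp: bij_betw_def)
  have other: "{a k, a l} \<in> insert {a j, a (Suc j)} C \<longleftrightarrow> a l < a k"
    if kl: "1 \<le> k" "k < l" "l \<le> m" and ne: "\<not> (k = j \<and> l = Suc j)" for k l
  proof -
    have "{a k, a l} \<noteq> {a j, a (Suc j)}"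
    proof
      assume "{a k, a l} = {a j, a (Suc j)}"
      then have "a k = a j \<and> a l = a (Suc j) \<or> a k = a (Suc j) \<and> a l = a j"
        unfolding doubleton_eq_iff .
      then have "k = j \<and> l = Suc j \<or> k = Suc j \<and> l = j"
        using inj[of k j] inj[of l "Suc j"] inj[of k "Suc j"] inj[of l j] kl j
        by (elim disjE) auto
      then show False using ne kl by linarith
    qed
    then show ?thesis using inv[OF kl] by simp
  qed
  show ?thesis
  proof (rule inversion_stateI[OF bij'])
    fix U assume "U \<in> insert {a j, a (Suc j)} C"
    then show "U \<subseteq> S" using sub[of U] aS by blast
  next
    fix k l assume kl: "1 \<le> k" "k < l" "l \<le> m"
    have "{a (?s k), a (?s l)} \<in> insert {a j, a (Suc j)} C \<longleftrightarrow> a (?s l) < a (?s k)"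
    proof (cases "k = j \<and> l = Suc j")
      case True
      then have "?s k = Suc j" "?s l = j" by simp_all
      then show ?thesis using less by (simp add: insert_commute)
    next
      case False
      show ?thesis
      proof (rule other)
        show "1 \<le> ?s k" "?s k < ?s l" "?s l \<le> m" "\<not> (?s k = j \<and> ?s l = Suc j)"
          using False kl j by (auto simp: Transposition.transpose_def split: if_splits)
      qed
    qed
    then show "{(a \<circ> ?s) k, (a \<circ> ?s) l} \<in> insert {a j, a (Suc j)} C \<longleftrightarrow> (a \<circ> ?s) l < (a \<circ> ?s) k"
      by (simp only: o_apply)
  qed
qed

text \<open>A new row puts its own pipe in front of the word; being smaller than all others, it is in no inversion.\<close>

lemma inversion_state_Cons:
  assumes st: "inversion_state a C m {Suc i..n}" and "i \<le> n"
    and first: "b 1 = i" and rest: "\<And>k. k \<in> {1..m} \<Longrightarrow> b (Suc k) = a k"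
  shows "inversion_state b C (Suc m) {i..n}"
proof -
  note bij = inversion_stateD(1)[OF st] and sub = inversion_stateD(2)[OF st]
    and inv = inversion_stateD(3)[OF st]
  have img: "a ` {1..m} = {Suc i..n}" by (rule bij_betw_imp_surj_on[OF bij])
  have b: "b k = (if k = 1 then i else a (k - 1))" if "k \<in> {1..Suc m}" for k
    using first rest[of "k - 1"] that by (cases "k = 1"; cases k) auto
  have dom: "{1..Suc m} = insert 1 (Suc ` {1..m})"
    by (auto simp: image_Suc_atLeastAtMost)
  have "b ` (Suc ` {1..m}) = {Suc i..n}"
    unfolding img[symmetric] image_image using rest by (intro image_cong) simp_all
  then have "b ` {1..Suc m} = insert i {Suc i..n}"
    unfolding dom image_insert using first by simp
  also have "\<dots> = {i..n}" using \<open>i \<le> n\<close> by auto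
  finally have img': "b ` {1..Suc m} = {i..n}" .
  have "card {1..m} = card {Suc i..n}" using bij by (rule bij_betw_same_card)
  then have "card (b ` {1..Suc m}) = card {1..Suc m}" unfolding img' using \<open>i \<le> n\<close> by simp
  then have "inj_on b {1..Suc m}" by (intro eq_card_imp_inj_on) simp_all
  then have bij': "bij_betw b {1..Suc m} {i..n}" using img' by (rule bij_betw_imageI)
  show ?thesis
  proof (rule inversion_stateI[OF bij'])
    fix U assume "U \<in> C"
    from sub[OF this] show "U \<subseteq> {i..n}" by auto
  next
    fix k l assume kl: "1 \<le> k" "k < l" "l \<le> Suc m"
    then have l: "b l = a (l - 1)" using b[of l] by simp
    show "{b k, b l} \<in> C \<longleftrightarrow> b l < b k"
    proof (cases "k = 1")
      case True
      have "a (l - 1) \<in> {Suc i..n}" unfolding img[symmetric] using kl by (intro imageI) auto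
      moreover have "{i, a (l - 1)} \<notin> C" using sub[of "{i, a (l - 1)}"] by auto
      ultimately show ?thesis using True first l by simp
    next
      case False
      then have "b k = a (k - 1)" using b[of k] kl by simp
      then show ?thesis using inv[of "k - 1" "l - 1"] kl False l by simp
    qed
  qed
qed

lemma word_Suc:
  "1 \<le> j \<Longrightarrow> word n T i (Suc j) k = (if k = j then bottom_pipe n T (i - 1, j)
     else if k = Suc j then left_pipe n T (i, Suc j) else word n T i j k)"
  by (auto simp: word_def less_Suc_eq)

lemma word_next_row:
  assumes "1 \<le> k" "k \<le> n"
  shows "word n T i 1 (Suc k) = word n T (Suc i) (Suc n) k"
  using assms by (auto simp: word_def)

lemma word_at_cell:
  "word n T i j j = left_pipe n T (i, j)" "word n T i j (Suc j) = bottom_pipe n T (i, j)"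
  by (simp_all add: word_def)

lemma pipe_dream_tile:
  assumes "is_pipe_dream n P" "(i, j) \<in> grid n"
  shows "i + j \<le> n \<Longrightarrow> P (i, j) = Bump \<or> P (i, j) = Cross"
    "i + j = n + 1 \<Longrightarrow> P (i, j) = JTile" "n + 1 < i + j \<Longrightarrow> P (i, j) = Blank"
  using assms(1)[unfolded pipe_dream_iff, rule_format, of i j] assms(2) by simp_all

lemma pipe_dream_left: "is_pipe_dream n P \<Longrightarrow> i \<in> {1..n} \<Longrightarrow> left_pipe n P (i, 1) = i"
  by (simp add: left_pipe_first_column[unfolded One_nat_def] is_pipe_dream_def)

text \<open>The invariant of tracing a pipe dream. A cross tile whose pipes have not crossed meets them in
  increasing order and exchanges them; every other tile leaves the word as it is, and a repeated
  cross meets an inversion that is already recorded.\<close>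

lemma pipe_dream_state:
  assumes P: "is_pipe_dream n P" and ij: "i \<in> {1..n}" "j \<in> {1..Suc n}"
  shows "inversion_state (word n P i j) (crossed n P (i, j)) (Suc n - i) {i..n} \<and>
    (\<forall>k. Suc n - i < k \<and> k \<le> Suc n \<longrightarrow> word n P i j k = 0)"
  using ij
proof (induction i j rule: reading_induct)
  case first
  show ?case
  proof (cases "n = 0")
    case False
    then have "word n P n 1 1 = n" using pipe_dream_left[OF P, of n] by (simp add: word_def)
    moreover have "word n P n 1 k = 0" if "1 < k" for k
      using that by (simp add: word_def bottom_pipe_last_row)
    ultimately show ?thesis
      by (auto simp: inversion_state_def crossed_first[unfolded One_nat_def] bij_betw_def)
  qed (use ij in auto)
next
  case (cell i j)
  let ?a = "word n P i j" and ?C = "crossed n P (i, j)" and ?m = "Suc n - i"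
  have c: "(i, j) \<in> grid n" using cell by (auto simp: grid_def)
  have st: "inversion_state ?a ?C ?m {i..n}"
    and zero: "\<And>k. Suc n - i < k \<Longrightarrow> k \<le> Suc n \<Longrightarrow> ?a k = 0"
    using cell.IH by auto
  note out = left_pipe_Suc[OF c, of P] bottom_pipe_pred[OF c, of P]
  note tile = pipe_dream_tile[OF P c]
  let ?swap = "P (i, j) = Cross \<and> {?a j, ?a (Suc j)} \<notin> ?C"
  have step: "word n P i (Suc j) k = (if ?swap then (?a \<circ> Transposition.transpose j (Suc j)) k else ?a k)"
    for k
  proof -
    have "?a j = 0" if "n + 1 < i + j" using zero[of j] that cell by auto
    moreover have "?a (Suc j) = 0" if "n + 1 \<le> i + j" using zero[of "Suc j"] that cell by auto
    ultimately show ?thesis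
      using tile out cell(2) unfolding word_at_cell
      by (cases "i + j \<le> n"; cases "i + j = n + 1")
        (auto simp: word_Suc Transposition.transpose_def word_at_cell right_exit_def top_exit_def)
  qed
  show ?case
  proof (cases ?swap)
    case True
    then have le: "i + j \<le> n" using tile by (cases "i + j \<le> n"; cases "i + j = n + 1") auto
    have jm: "1 \<le> j" "j < ?m" using le cell by auto
    have "?a j \<noteq> ?a (Suc j)"
      using inversion_stateD(1)[OF st] jm inj_on_eq_iff[of ?a "{1..?m}" j "Suc j"]
      by (simp add: bij_betw_def)
    moreover have "\<not> ?a (Suc j) < ?a j"
      using inversion_stateD(3)[OF st, of j "Suc j"] jm True by simp
    ultimately have less: "?a j < ?a (Suc j)" by simp
    have C: "crossed n P (i, Suc j) = insert {?a j, ?a (Suc j)} ?C"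
      using True crossed_Suc[OF c, of P] by (simp add: word_at_cell)
    have "inversion_state (word n P i (Suc j)) (crossed n P (i, Suc j)) ?m {i..n}"
      unfolding C by (rule inversion_state_cong[OF inversion_state_swap[OF st jm less]])
        (use True step in simp)
    moreover have "word n P i (Suc j) k = 0" if "?m < k" "k \<le> Suc n" for k
      using that zero[of k] jm True unfolding step by (simp add: Transposition.transpose_def)
    ultimately show ?thesis by blast
  next
    case False
    then have "crossed n P (i, Suc j) = ?C"
      using crossed_Suc[OF c, of P] by (auto simp: word_at_cell)
    moreover have "word n P i (Suc j) = ?a" using step False by (intro ext) auto
    ultimately show ?thesis using cell.IH by simp
  qed
next
  case (row i)
  let ?a = "word n P (Suc i) (Suc n)"
  have st: "inversion_state ?a (crossed n P (i, 1)) (n - i) {Suc i..n}"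
    and zero: "\<And>k. n - i < k \<Longrightarrow> k \<le> Suc n \<Longrightarrow> ?a k = 0"
    using row.IH unfolding crossed_next_row by auto
  have "inversion_state (word n P i 1) (crossed n P (i, 1)) (Suc (n - i)) {i..n}"
  proof (rule inversion_state_Cons[OF st])
    show "word n P i 1 1 = i" using pipe_dream_left[OF P, of i] row by (simp add: word_def)
    show "word n P i 1 (Suc k) = ?a k" if "k \<in> {1..n - i}" for k
      using that by (intro word_next_row) auto
  qed (use row in auto)
  moreover have "word n P i 1 k = 0" if "Suc n - i < k" "k \<le> Suc n" for k
    using zero[of "k - 1"] word_next_row[of "k - 1" n P i] that row by auto
  ultimately show ?case using row by (simp add: Suc_diff_le)
qed


lemma pipe_dream_pipes:
  assumes P: "is_pipe_dream n P" and c: "(i, j) \<in> grid n"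
  defines "p \<equiv> left_pipe n P (i, j)" and "q \<equiv> bottom_pipe n P (i, j)"
  shows "i + j \<le> n \<Longrightarrow> p \<in> {i..n} \<and> q \<in> {i..n} \<and> p \<noteq> q \<and> ({p, q} \<in> crossed n P (i, j) \<longleftrightarrow> q < p)"
    and "i + j = n + 1 \<Longrightarrow> p \<in> {i..n} \<and> q = 0"
    and "n + 1 < i + j \<Longrightarrow> p = 0 \<and> q = 0"
proof -
  let ?a = "word n P i j" and ?m = "Suc n - i"
  have ij: "i \<in> {1..n}" "j \<in> {1..Suc n}" using c by (auto simp: grid_def)
  have st: "inversion_state ?a (crossed n P (i, j)) ?m {i..n}"
    and zero: "\<And>k. ?m < k \<Longrightarrow> k \<le> Suc n \<Longrightarrow> ?a k = 0"
    using pipe_dream_state[OF P ij] by auto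
  have pq: "p = ?a j" "q = ?a (Suc j)" unfolding p_def q_def word_at_cell by simp_all
  have mem: "?a k \<in> {i..n}" if "1 \<le> k" "k \<le> ?m" for k
    using bij_betwE[OF inversion_stateD(1)[OF st]] that by simp
  show "p \<in> {i..n} \<and> q \<in> {i..n} \<and> p \<noteq> q \<and> ({p, q} \<in> crossed n P (i, j) \<longleftrightarrow> q < p)" if "i + j \<le> n"
  proof -
    have m: "Suc j \<le> ?m" using that by simp
    have "?a j \<noteq> ?a (Suc j)"
      using inj_on_eq_iff[OF bij_betw_imp_inj_on[OF inversion_stateD(1)[OF st]], of j "Suc j"] m ij by simp
    then show ?thesis
      unfolding pq using mem[of j] mem[of "Suc j"] inversion_stateD(3)[OF st, of j "Suc j"] m ij by simp
  qed
  show "p \<in> {i..n} \<and> q = 0" if "i + j = n + 1"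
    unfolding pq using mem[of j] zero[of "Suc j"] that ij by simp
  show "p = 0 \<and> q = 0" if "n + 1 < i + j"
    unfolding pq using zero[of j] zero[of "Suc j"] that c by (auto simp: grid_def)
qed

text \<open>Since crossed means inverted, the larger pipe always leaves a cross tile through the top.\<close>

lemma pipe_dream_cross:
  assumes P: "is_pipe_dream n P" and c: "(i, j) \<in> grid n" and X: "P (i, j) = Cross"
  defines "p \<equiv> left_pipe n P (i, j)" and "q \<equiv> bottom_pipe n P (i, j)"
  shows "p \<in> {i..n}" "q \<in> {i..n}" "p \<noteq> q" "{p, q} \<in> crossed n P (i, j) \<longleftrightarrow> q < p"
    "left_pipe n P (i, Suc j) = min p q" "bottom_pipe n P (i - 1, j) = max p q"
proof -
  have "i + j \<le> n"
    using pipe_dream_tile[OF P c] X by (cases "i + j \<le> n"; cases "i + j = n + 1") auto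
  note pq = pipe_dream_pipes(1)[OF P c this, folded p_def q_def]
  then show "p \<in> {i..n}" "q \<in> {i..n}" "p \<noteq> q" "{p, q} \<in> crossed n P (i, j) \<longleftrightarrow> q < p"
    by auto
  show "left_pipe n P (i, Suc j) = min p q" "bottom_pipe n P (i - 1, j) = max p q"
    using left_pipe_Suc[OF c, of P] bottom_pipe_pred[OF c, of P] X pq
    unfolding p_def[symmetric] q_def[symmetric]
    by (auto simp: right_exit_def top_exit_def min_def max_def)
qed

lemma pipe_dream_exits:
  assumes P: "is_pipe_dream n P"
  shows "inversion_state (exit_pipe n P) (crossed n P (1, Suc n)) n {1..n}"
proof (cases "n = 0")
  case True
  then show ?thesis
    by (simp add: inversion_state_def crossed_def grid_def bij_betw_def)
next
  case False
  then have st: "inversion_state (word n P 1 (Suc n)) (crossed n P (1, Suc n)) (Suc n - 1) {1..n}"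
    using pipe_dream_state[OF P, of 1 "Suc n"] by auto
  show ?thesis
    by (rule inversion_state_cong[of "word n P 1 (Suc n)"]) (use st in \<open>auto simp: exit_pipe_def word_def\<close>)
qed

section \<open>Hiding pipes\<close>

definition mask :: "nat set \<Rightarrow> nat \<Rightarrow> nat" where
  "mask V p = (if p \<in> V then p else 0)"

text \<open>The tile that remains when pipes are made invisible; \<open>l\<close> and \<open>b\<close> tell whether the left and the
  bottom pipe are visible. Crossing tiles with at least one visible pipe become the tiles that count for
  the weight of an MVPD.\<close>

fun hide :: "tile \<Rightarrow> bool \<Rightarrow> bool \<Rightarrow> tile" where
  "hide Bump l b = (if l then (if b then Bump else JTile) else (if b then RTile else Blank))"
| "hide Cross l b = (if l then (if b then Cross else HTile) else (if b then MarkedRTile else Blank))"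
| "hide JTile l b = (if l then JTile else Blank)"
| "hide t l b = t"

lemma mask_nonzero: "0 \<notin> V \<Longrightarrow> mask V p \<noteq> 0 \<longleftrightarrow> p \<in> V"
  unfolding mask_def by (cases "p = 0") auto

definition masked :: "nat \<Rightarrow> nat set \<Rightarrow> tiling \<Rightarrow> tiling \<Rightarrow> cell \<Rightarrow> bool" where
  "masked n V P M c \<longleftrightarrow>
     left_pipe n M c = mask V (left_pipe n P c) \<and> bottom_pipe n M c = mask V (bottom_pipe n P c)"

text \<open>The second condition excludes the cross tiles for which hiding would lose a weight cell or misroute
  the visible pipe: an H-tile or marked R-tile sends it to the right, so it has to be the
  smaller one of the two.\<close>

definition hidden :: "nat \<Rightarrow> nat set \<Rightarrow> tiling \<Rightarrow> tiling \<Rightarrow> cell \<Rightarrow> bool" where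
  "hidden n V P M c \<longleftrightarrow> M c = hide (P c) (left_pipe n P c \<in> V) (bottom_pipe n P c \<in> V) \<and>
     (P c = Cross \<longrightarrow> min (left_pipe n P c) (bottom_pipe n P c) \<in> V)"

lemma hide_eq_Cross: "hide t l b = Cross \<longleftrightarrow> t = Cross \<and> l \<and> b"
  by (cases t) auto

text \<open>Tracing after hiding consults the crossing history only for two visible pipes, and these
  meet in a cross tile before hiding exactly when they do so after hiding.\<close>

lemma crossed_masked:
  assumes "\<And>d. d \<in> grid n \<Longrightarrow> d \<prec> c \<Longrightarrow> hidden n V P M d \<and> masked n V P M d"
    and "p \<in> V" "q \<in> V"
  shows "{p, q} \<in> crossed n M c \<longleftrightarrow> {p, q} \<in> crossed n P c"
proof
  assume "{p, q} \<in> crossed n M c"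
  then obtain d where d: "d \<in> grid n" "d \<prec> c" "M d = Cross"
    "{p, q} = {left_pipe n M d, bottom_pipe n M d}" unfolding crossed_def by blast
  then show "{p, q} \<in> crossed n P c"
    using assms(1)[OF d(1,2)] unfolding hidden_def masked_def crossed_def mask_def
    by (auto simp: hide_eq_Cross)
next
  assume "{p, q} \<in> crossed n P c"
  then obtain d where d: "d \<in> grid n" "d \<prec> c" "P d = Cross"
    and pq: "{p, q} = {left_pipe n P d, bottom_pipe n P d}" unfolding crossed_def by blast
  have V: "left_pipe n P d \<in> V" "bottom_pipe n P d \<in> V"
    using assms(2,3) pq by (auto simp: doubleton_eq_iff)
  then have "M d = Cross" "{p, q} = {left_pipe n M d, bottom_pipe n M d}"
    using assms(1)[OF d(1,2)] d(3) pq unfolding hidden_def masked_def mask_def by simp_all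
  then show "{p, q} \<in> crossed n M c" using d unfolding crossed_def by blast
qed

text \<open>One step of the comparison of the two traces. At a cross tile with one visible pipe, that pipe
  is the smaller one and hence leaves to the right in the pipe dream; this is also where an H-tile and a
  marked R-tile send it.\<close>

lemma outputs_masked:
  assumes P: "is_pipe_dream n P" and V: "0 \<notin> V" and c: "(i, j) \<in> grid n"
    and here: "hidden n V P M (i, j)" "masked n V P M (i, j)"
    and before: "\<And>d. d \<in> grid n \<Longrightarrow> d \<prec> (i, j) \<Longrightarrow> hidden n V P M d \<and> masked n V P M d"
  shows "left_pipe n M (i, Suc j) = mask V (left_pipe n P (i, Suc j))"
    "bottom_pipe n M (i - 1, j) = mask V (bottom_pipe n P (i - 1, j))"
proof -
  let ?p = "left_pipe n P (i, j)" and ?q = "bottom_pipe n P (i, j)"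
  have M: "M (i, j) = hide (P (i, j)) (?p \<in> V) (?q \<in> V)"
    and L: "left_pipe n M (i, j) = mask V ?p" and B: "bottom_pipe n M (i, j) = mask V ?q"
    using here unfolding hidden_def masked_def by auto
  define x where "x \<longleftrightarrow> {mask V ?p, mask V ?q} \<in> crossed n M (i, j)"
  have outM: "left_pipe n M (i, Suc j) = right_exit (M (i, j)) (mask V ?p) (mask V ?q) x"
    "bottom_pipe n M (i - 1, j) = top_exit (M (i, j)) (mask V ?p) (mask V ?q) x"
    using left_pipe_Suc[OF c, of M] bottom_pipe_pred[OF c, of M] unfolding L B x_def by simp_all
  have "left_pipe n M (i, Suc j) = mask V (left_pipe n P (i, Suc j)) \<and>
    bottom_pipe n M (i - 1, j) = mask V (bottom_pipe n P (i - 1, j))"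
  proof (cases "P (i, j) = Cross")
    case True
    note cross = pipe_dream_cross[OF P c True]
    have min: "min ?p ?q \<in> V" using here True unfolding hidden_def by simp
    consider "?p \<in> V" "?q \<in> V" | "?p \<in> V" "?q \<notin> V" "?p < ?q" | "?p \<notin> V" "?q \<in> V" "?q < ?p"
      using min cross(3) by (cases "?p < ?q") (auto simp: min_def)
    then show ?thesis
    proof cases
      case 1
      then have "x \<longleftrightarrow> ?q < ?p"
        using crossed_masked[of n "(i, j)" V P M ?p ?q, OF before] cross(4)
        unfolding x_def by (simp add: mask_def)
      then show ?thesis
        unfolding outM cross(5,6) M using 1 True
        by (simp add: mask_def right_exit_def top_exit_def)
    next
      case 2
      then show ?thesis
        unfolding outM cross(5,6) M using True by (simp add: mask_def right_exit_def top_exit_def)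
    next
      case 3
      then show ?thesis
        unfolding outM cross(5,6) M using True by (simp add: mask_def right_exit_def top_exit_def)
    qed
  next
    case False
    have tile: "P (i, j) = Bump \<or> P (i, j) = JTile \<or> P (i, j) = Blank"
      using False pipe_dream_tile[OF P c] by (cases "i + j \<le> n"; cases "i + j = n + 1") auto
    show ?thesis
      unfolding outM left_pipe_Suc[OF c, of P] bottom_pipe_pred[OF c, of P] M using tile V
      by (elim disjE) (simp_all add: mask_def right_exit_def top_exit_def)
  qed
  then show "left_pipe n M (i, Suc j) = mask V (left_pipe n P (i, Suc j))"
    "bottom_pipe n M (i - 1, j) = mask V (bottom_pipe n P (i - 1, j))" by auto
qed

text \<open>The comparison of traces as an induction principle: at each cell only the tiles have to be
  related, and for this both the tiles at all earlier cells and the pipes at the cell itself are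
  already known to correspond.\<close>

lemma masked_everywhere:
  assumes P: "is_pipe_dream n P" and V: "0 \<notin> V"
    and first: "\<And>i. i \<in> {1..n} \<Longrightarrow> left_pipe n M (i, 1) = mask V i"
    and hidden: "\<And>c. c \<in> grid n \<Longrightarrow> masked n V P M c \<Longrightarrow>
      (\<And>d. d \<in> grid n \<Longrightarrow> d \<prec> c \<Longrightarrow> hidden n V P M d \<and> masked n V P M d) \<Longrightarrow> hidden n V P M c"
    and c: "c \<in> grid n"
  shows "hidden n V P M c \<and> masked n V P M c"
  using c
proof (induction c rule: cell_induct[of n])
  case (step c)
  obtain i j where cij: "c = (i, j)" and ij: "i \<in> {1..n}" "j \<in> {1..n}"
    using step.prems by (auto simp: grid_def)
  have out: "left_pipe n M (i', Suc j') = mask V (left_pipe n P (i', Suc j'))"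
    "bottom_pipe n M (i' - 1, j') = mask V (bottom_pipe n P (i' - 1, j'))"
    if "(i', j') \<in> grid n" "(i', j') \<prec> c" for i' j'
  proof -
    have here: "hidden n V P M (i', j')" "masked n V P M (i', j')"
      using step.IH[OF that(1,2) that(1)] by auto
    have before: "hidden n V P M d \<and> masked n V P M d" if "d \<in> grid n" "d \<prec> (i', j')" for d
      using step.IH[OF that(1) _ that(1)] precedes_trans[OF that(2) \<open>(i', j') \<prec> c\<close>] by blast
    show "left_pipe n M (i', Suc j') = mask V (left_pipe n P (i', Suc j'))"
      "bottom_pipe n M (i' - 1, j') = mask V (bottom_pipe n P (i' - 1, j'))"
      using outputs_masked[OF P V that(1) here before] by auto
  qed
  have "left_pipe n M (i, j) = mask V (left_pipe n P (i, j))"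
  proof (cases "j = 1")
    case True
    then show ?thesis using first pipe_dream_left[OF P] ij by simp
  next
    case False
    then show ?thesis using out(1)[of i "j - 1"] ij cij by (auto simp: grid_def precedes_def)
  qed
  moreover have "bottom_pipe n M (i, j) = mask V (bottom_pipe n P (i, j))"
  proof (cases "i = n")
    case True
    then show ?thesis using V by (simp add: bottom_pipe_last_row mask_def)
  next
    case False
    then show ?thesis using out(2)[of "Suc i" j] ij cij by (auto simp: grid_def precedes_def)
  qed
  ultimately have masked: "masked n V P M c" unfolding masked_def cij by simp
  then show ?case using hidden[OF step.prems masked] step.IH by blast
qed

lemma exit_pipe_masked:
  assumes P: "is_pipe_dream n P" and V: "0 \<notin> V" and k: "k \<in> {1..n}"
    and all: "\<And>c. c \<in> grid n \<Longrightarrow> hidden n V P M c \<and> masked n V P M c"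
  shows "exit_pipe n M k = mask V (exit_pipe n P k)"
proof -
  have "(1, k) \<in> grid n" using k by (auto simp: grid_def)
  from outputs_masked(2)[OF P V this, of M] all this show ?thesis
    unfolding exit_pipe_def by simp
qed


section \<open>From pipe dreams to marked vertical-less pipe dreams\<close>

definition hide_pipes :: "nat \<Rightarrow> nat set \<Rightarrow> tiling \<Rightarrow> tiling" where
  "hide_pipes n V P c = (if c \<in> grid n
     then hide (P c) (left_pipe n P c \<in> V) (bottom_pipe n P c \<in> V) else Blank)"

definition lower_visible :: "nat \<Rightarrow> nat set \<Rightarrow> tiling \<Rightarrow> bool" where
  "lower_visible n V P \<longleftrightarrow>
     (\<forall>c\<in>grid n. P c = Cross \<longrightarrow> min (left_pipe n P c) (bottom_pipe n P c) \<in> V)"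

text \<open>A strand survives on an edge of a cell exactly when the pipe through that edge is visible, on all
  four edges. This makes matching automatic, since neighbouring cells share the pipe on their common edge.\<close>

lemma hide_pipes_edges:
  assumes P: "is_pipe_dream n P" and V: "0 \<notin> V" and low: "lower_visible n V P"
    and c: "(i, j) \<in> grid n"
  defines "M \<equiv> hide_pipes n V P"
  shows "has_left (M (i, j)) \<longleftrightarrow> left_pipe n P (i, j) \<in> V"
    "has_bottom (M (i, j)) \<longleftrightarrow> bottom_pipe n P (i, j) \<in> V"
    "has_right (M (i, j)) \<longleftrightarrow> left_pipe n P (i, Suc j) \<in> V"
    "has_top (M (i, j)) \<longleftrightarrow> bottom_pipe n P (i - 1, j) \<in> V"
proof -
  let ?p = "left_pipe n P (i, j)" and ?q = "bottom_pipe n P (i, j)"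
  have M: "M (i, j) = hide (P (i, j)) (?p \<in> V) (?q \<in> V)"
    using c unfolding M_def hide_pipes_def by simp
  have "(has_left (M (i, j)) \<longleftrightarrow> ?p \<in> V) \<and> (has_bottom (M (i, j)) \<longleftrightarrow> ?q \<in> V) \<and>
    (has_right (M (i, j)) \<longleftrightarrow> left_pipe n P (i, Suc j) \<in> V) \<and>
    (has_top (M (i, j)) \<longleftrightarrow> bottom_pipe n P (i - 1, j) \<in> V)"
  proof (cases "P (i, j) = Cross")
    case True
    note cross = pipe_dream_cross[OF P c True]
    have "min ?p ?q \<in> V" using low c True unfolding lower_visible_def by blast
    then show ?thesis
      unfolding cross(5,6) M True by (cases "?p \<le> ?q") (simp_all add: edge_simps min_def max_def)
  next
    case False
    note pipes = pipe_dream_pipes[OF P c] and tile = pipe_dream_tile[OF P c]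
    consider "P (i, j) = Bump" | "P (i, j) = JTile" "?q = 0" | "P (i, j) = Blank" "?p = 0" "?q = 0"
      using False pipes tile by (cases "i + j \<le> n"; cases "i + j = n + 1") auto
    then show ?thesis
      unfolding left_pipe_Suc[OF c, of P] bottom_pipe_pred[OF c, of P] M using V
      by cases (simp_all add: edge_simps right_exit_def top_exit_def)
  qed
  then show "has_left (M (i, j)) \<longleftrightarrow> left_pipe n P (i, j) \<in> V"
    "has_bottom (M (i, j)) \<longleftrightarrow> bottom_pipe n P (i, j) \<in> V"
    "has_right (M (i, j)) \<longleftrightarrow> left_pipe n P (i, Suc j) \<in> V"
    "has_top (M (i, j)) \<longleftrightarrow> bottom_pipe n P (i - 1, j) \<in> V" by blast+
qed

lemma hide_pipes_tiling:
  assumes P: "is_pipe_dream n P" and V: "0 \<notin> V" and low: "lower_visible n V P"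
  shows "is_tiling n (unmark \<circ> hide_pipes n V P)"
proof -
  let ?M = "hide_pipes n V P"
  note edges = hide_pipes_edges[OF P V low]
  have outside: "?M c = Blank" if "c \<notin> grid n" for c using that by (simp add: hide_pipes_def)
  have right: "has_right (?M (i, j)) \<longleftrightarrow> has_left (?M (i, Suc j))" if c: "(i, j) \<in> grid n" for i j
  proof (cases "j = n")
    case True
    have "left_pipe n P (i, Suc n) = 0"
    proof -
      have "i + n = n + 1 \<or> n + 1 < i + n" using c by (auto simp: grid_def)
      then have "P (i, n) = JTile \<or> P (i, n) = Blank"
        using pipe_dream_tile[OF P, of i n] c True by auto
      then show ?thesis
        using left_pipe_Suc[of i n n P] c True by (auto simp: right_exit_def)
    qed
    then show ?thesis using edges(3)[OF c] outside[of "(i, Suc j)"] True V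
      by (simp add: grid_def edge_simps)
  next
    case False
    then have "(i, Suc j) \<in> grid n" using c by (auto simp: grid_def)
    then show ?thesis using edges(1) edges(3)[OF c] by blast
  qed
  have bottom: "has_bottom (?M (i, j)) \<longleftrightarrow> has_top (?M (Suc i, j))" if c: "(i, j) \<in> grid n" for i j
  proof (cases "i = n")
    case True
    then show ?thesis using edges(2)[OF c] outside[of "(Suc i, j)"] V bottom_pipe_last_row[of n P j]
      by (simp add: grid_def edge_simps)
  next
    case False
    then have "(Suc i, j) \<in> grid n" using c by (auto simp: grid_def)
    from edges(4)[OF this] show ?thesis using edges(2)[OF c] by simp
  qed
  moreover have "unmark Blank = Blank" by (simp add: unmark.simps)
  ultimately show ?thesis
    unfolding is_tiling_def using outside right by (simp add: grid_def)
qed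

lemma hide_pipes_masked:
  assumes P: "is_pipe_dream n P" and V: "0 \<notin> V" and low: "lower_visible n V P"
    and c: "c \<in> grid n"
  shows "hidden n V P (hide_pipes n V P) c \<and> masked n V P (hide_pipes n V P) c"
proof (rule masked_everywhere[OF P V _ _ c])
  fix i assume i: "i \<in> {1..n}"
  then have "(i, 1) \<in> grid n" by (auto simp: grid_def)
  from hide_pipes_edges(1)[OF P V low this, unfolded pipe_dream_left[OF P i]]
  show "left_pipe n (hide_pipes n V P) (i, 1) = mask V i"
    unfolding left_pipe_first_column by (simp add: mask_def)
next
  fix c assume "c \<in> grid n"
  then show "hidden n V P (hide_pipes n V P) c"
    using low unfolding hidden_def lower_visible_def hide_pipes_def by simp
qed

text \<open>A crossed pair has a first common cross tile, and there the smaller pipe comes from the left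
  because the pair is not yet inverted.\<close>

lemma first_crossing:
  assumes P: "is_pipe_dream n P" and pq: "{p, q} \<in> crossed n P c" "q < p"
  shows "\<exists>d\<in>grid n. d \<prec> c \<and> P d = Cross \<and> left_pipe n P d = q \<and> bottom_pipe n P d = p"
  using pq(1)
proof (induction c rule: cell_induct[of n])
  case (step c)
  then obtain d where d: "d \<in> grid n" "d \<prec> c" "P d = Cross"
    "{p, q} = {left_pipe n P d, bottom_pipe n P d}" unfolding crossed_def by blast
  obtain i j where dij: "d = (i, j)" by fastforce
  show ?case
  proof (cases "{p, q} \<in> crossed n P d")
    case True
    from step.IH[OF d(1,2) this] show ?thesis using precedes_trans d(2) by blast
  next
    case False
    then have "\<not> bottom_pipe n P d < left_pipe n P d"
      using pipe_dream_cross(4)[OF P d(1,3)[unfolded dij]] d(4) unfolding dij by simp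
    then have "left_pipe n P d = q" "bottom_pipe n P d = p"
      using d(4) pq(2) unfolding doubleton_eq_iff by auto
    then show ?thesis using d by blast
  qed
qed

text \<open>The marks are legal: at a marked tile the visible pipe has crossed the invisible one before, and
  their first crossing has the visible pipe coming from the left, so hiding turns it into an
  H-tile.\<close>

lemma hide_pipes_MVPD:
  assumes P: "is_pipe_dream n P" and V: "0 \<notin> V" and low: "lower_visible n V P"
  shows "is_MVPD n (hide_pipes n V P)"
proof -
  let ?M = "hide_pipes n V P"
  have masked: "left_pipe n ?M c = mask V (left_pipe n P c)"
    "bottom_pipe n ?M c = mask V (bottom_pipe n P c)" if "c \<in> grid n" for c
    using hide_pipes_masked[OF P V low that] unfolding masked_def by auto
  have "\<exists>(i', j')\<in>grid n. i < i' \<and> ?M (i', j') = HTile \<and>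
      left_pipe n ?M (i', j') = bottom_pipe n ?M (i, j)"
    if c: "(i, j) \<in> grid n" and mark: "?M (i, j) = MarkedRTile" for i j
  proof -
    let ?p = "left_pipe n P (i, j)" and ?q = "bottom_pipe n P (i, j)"
    have "hide (P (i, j)) (?p \<in> V) (?q \<in> V) = MarkedRTile"
      using mark c unfolding hide_pipes_def by simp
    moreover have "P (i, j) \<noteq> MarkedRTile"
      using pipe_dream_tile[OF P c] by (cases "i + j \<le> n"; cases "i + j = n + 1") auto
    ultimately have cross: "P (i, j) = Cross" and vis: "?p \<notin> V" "?q \<in> V"
      by (cases "P (i, j)"; auto split: if_splits)+
    note at = pipe_dream_cross[OF P c cross]
    have "min ?p ?q \<in> V" using low c cross unfolding lower_visible_def by blast
    then have less: "?q < ?p" using vis at(3) by (cases "?p \<le> ?q") (auto simp: min_def)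
    then obtain d where d: "d \<in> grid n" "d \<prec> (i, j)" "P d = Cross"
      "left_pipe n P d = ?q" "bottom_pipe n P d = ?p"
      using first_crossing[OF P, of ?p ?q "(i, j)"] at(4) by blast
    obtain i' j' where dij: "d = (i', j')" by fastforce
    \<comment> \<open>In the same row, the larger pipe would leave the earlier cell through the top and hence
      could not enter \<open>(i, j)\<close> from the left: it would occur twice in the word.\<close>
    have "i' \<noteq> i"
    proof
      assume i: "i' = i"
      then have j: "j' < j" using d(2) dij by (simp add: precedes_def)
      have "bottom_pipe n P (i - 1, j') = ?p"
        using pipe_dream_cross(6)[OF P d(1,3)[unfolded dij]] d(4,5) less unfolding dij i by simp
      then have same: "word n P i j j' = word n P i j j" using j by (simp add: word_def)
      have "i + j \<le> n"
        using pipe_dream_tile[OF P c] cross by (cases "i + j \<le> n"; cases "i + j = n + 1") auto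
      then have "j \<in> {1..Suc n - i}" "j' \<in> {1..Suc n - i}" "i \<in> {1..n}" "j \<in> {1..Suc n}"
        using j c d(1) dij by (simp_all add: grid_def)
      moreover from this have "inj_on (word n P i j) {1..Suc n - i}"
        using pipe_dream_state[OF P, of i j] inversion_stateD(1) bij_betw_imp_inj_on by blast
      ultimately have "j' = j" using same inj_on_eq_iff by metis
      then show False using j by simp
    qed
    then have "i < i'" using d(2) dij by (auto simp: precedes_def)
    moreover have "?M d = HTile" using d vis unfolding hide_pipes_def by simp
    moreover have "left_pipe n ?M d = bottom_pipe n ?M (i, j)"
      using masked(1)[OF d(1)] masked(2)[OF c] d(4) by simp
    ultimately show ?thesis using d(1) unfolding dij by blast
  qed
  moreover have "unmark t \<in> {Blank, HTile, Cross, JTile, RTile, Bump}" for t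
    by (cases t) (simp_all add: unmark.simps)
  ultimately show ?thesis
    unfolding is_MVPD_def is_vertical_less_def using hide_pipes_tiling[OF P V low] by fastforce
qed

section \<open>From marked vertical-less pipe dreams to pipe dreams\<close>

text \<open>A strand on the right edge of a tile has to turn up before the right boundary, and a strand on
  a bottom edge comes with one on the right edge. So if all strands at the tops of a row lie in the first
  \<open>m + 1\<close> columns, those at its bottoms lie in the first \<open>m\<close>. Going down from the top row this confines
  the tiling to the staircase of a pipe dream.\<close>

lemma strands_below_antidiagonal:
  assumes T: "is_tiling n (unmark \<circ> T)" and c: "(i, j) \<in> grid n"
  shows "n + 1 \<le> i + j \<Longrightarrow> \<not> has_right (T (i, j))" "n + 1 < i + j \<Longrightarrow> T (i, j) = Blank"
proof -
  have match: "has_right (T (i, j)) \<longleftrightarrow> has_left (T (i, Suc j))"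
    "has_bottom (T (i, j)) \<longleftrightarrow> has_top (T (Suc i, j))" if "(i, j) \<in> grid n" for i j
    using tiling_match[OF T that] by simp_all
  have outside: "T c = Blank" if "c \<notin> grid n" for c
    using tiling_outside[OF T that] by (cases "T c") (auto simp: unmark.simps)
  have right: "\<not> has_right (T (i, j))"
    if top: "\<And>j. n + 1 < i + j \<Longrightarrow> \<not> has_top (T (i, j))" and i: "i \<in> {1..n}"
      and j: "j \<le> Suc n" "n + 1 \<le> i + j" for i j
    using j
  proof (induction j rule: inc_induct)
    case base
    then show ?case using outside[of "(i, Suc n)"] by (simp add: grid_def edge_simps)
  next
    case (step j)
    then have "(i, j) \<in> grid n" using i by (auto simp: grid_def)
    moreover have "\<not> has_right (T (i, Suc j))" "\<not> has_top (T (i, Suc j))"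
      using step.IH top[of "Suc j"] step.prems step.hyps by simp_all
    then have "\<not> has_left (T (i, Suc j))" by (auto simp: edge_simps)
    ultimately show ?case using match(1) by blast
  qed
  have top: "n + 1 < i + j \<longrightarrow> \<not> has_top (T (i, j))" if "1 \<le> i" "i \<le> n" for i j
    using that
  proof (induction i arbitrary: j rule: dec_induct)
    case base
    then show ?case using outside[of "(1, j)"] by (auto simp: grid_def edge_simps)
  next
    case (step i)
    show ?case
    proof
      assume j: "n + 1 < Suc i + j"
      show "\<not> has_top (T (Suc i, j))"
      proof (cases "(i, j) \<in> grid n")
        case True
        have "\<not> has_right (T (i, j))"
        proof (rule right)
          show "\<not> has_top (T (i, k))" if "n + 1 < i + k" for k using step.IH[of k] step.prems that by simp
        qed (use j True in \<open>auto simp: grid_def\<close>)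
        then have "\<not> has_bottom (T (i, j))" by (auto simp: edge_simps)
        then show ?thesis using match(2)[OF True] by simp
      next
        case False
        then show ?thesis using outside[of "(Suc i, j)"] step by (auto simp: grid_def edge_simps)
      qed
    qed
  qed
  show "\<not> has_right (T (i, j))" if "n + 1 \<le> i + j"
  proof (rule right)
    show "\<not> has_top (T (i, k))" if "n + 1 < i + k" for k
      using top[of i k] that c by (simp add: grid_def)
  qed (use that c in \<open>auto simp: grid_def\<close>)
  moreover have "\<not> has_top (T (i, j))" if "n + 1 < i + j"
    using top[of i j] that c by (simp add: grid_def)
  ultimately show "T (i, j) = Blank" if "n + 1 < i + j"
    using that by (cases "T (i, j)") (auto simp: edge_simps)
qed

text \<open>For an MVPD \<open>M\<close>, this is the only pipe dream that has its cross tiles at the weight cells of \<open>M\<close>.\<close>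

definition reveal :: "nat \<Rightarrow> tiling \<Rightarrow> tiling" where
  "reveal n M = (\<lambda>(i, j).
     if (i, j) \<notin> grid n \<or> n + 1 < i + j then Blank
     else if i + j = n + 1 then JTile
     else if M (i, j) \<in> {HTile, Cross, MarkedRTile} then Cross else Bump)"

lemma reveal_pipe_dream: "is_pipe_dream n (reveal n M)"
  unfolding pipe_dream_iff reveal_def by simp

definition entering :: "nat \<Rightarrow> tiling \<Rightarrow> nat set" where
  "entering n M = {r \<in> {1..n}. has_left (M (r, 1))}"

text \<open>That hiding the pipes which do not enter \<open>M\<close> turns the revealed tiles back into those of \<open>M\<close> is
  immediate from the strands on the left and bottom edges. The substance is that the smaller pipe of
  each cross tile is visible, which is proved together with the correspondence of the traces.\<close>

lemma reveal_masked:
  assumes M: "is_MVPD n M" and c: "c \<in> grid n"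
  shows "hidden n (entering n M) (reveal n M) M c \<and> masked n (entering n M) (reveal n M) M c"
proof -
  let ?V = "entering n M" and ?P = "reveal n M"
  note P = reveal_pipe_dream[of n M]
  have V: "0 \<notin> ?V" by (simp add: entering_def)
  have T: "is_tiling n (unmark \<circ> M)" using M unfolding is_MVPD_def is_vertical_less_def by blast
  show ?thesis
  proof (rule masked_everywhere[OF P V _ _ c])
    fix i assume "i \<in> {1..n}"
    then show "left_pipe n M (i, 1) = mask ?V i"
      unfolding left_pipe_first_column by (simp add: mask_def entering_def)
  next
    fix c assume c: "c \<in> grid n" and here: "masked n ?V ?P M c"
      and before: "\<And>d. d \<in> grid n \<Longrightarrow> d \<prec> c \<Longrightarrow> hidden n ?V ?P M d \<and> masked n ?V ?P M d"
    obtain i j where cij: "c = (i, j)" by fastforce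
    let ?p = "left_pipe n ?P c" and ?q = "bottom_pipe n ?P c"
    have cg: "(i, j) \<in> grid n" using c cij by simp
    have L: "has_left (M c) \<longleftrightarrow> ?p \<in> ?V" and B: "has_bottom (M c) \<longleftrightarrow> ?q \<in> ?V"
      using pipe_iff_strand[OF T c] here mask_nonzero[OF V] unfolding masked_def by simp_all
    have tile: "?P c = (if n + 1 < i + j then Blank else if i + j = n + 1 then JTile
        else if M c \<in> {HTile, Cross, MarkedRTile} then Cross else Bump)"
      using cg unfolding cij reveal_def by simp
    have hide: "M c = hide (?P c) (?p \<in> ?V) (?q \<in> ?V)"
      unfolding L[symmetric] B[symmetric] tile
      using strands_below_antidiagonal[OF T cg] unfolding cij
      by (cases "M (i, j)") (auto simp: edge_simps)
    have low: "min (left_pipe n ?P d) (bottom_pipe n ?P d) \<in> ?V"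
      if "d \<in> grid n" "d \<prec> c" "?P d = Cross" for d
      using before[OF that(1,2)] that(3) unfolding hidden_def by blast
    have low_crossed: "min x y \<in> ?V" if xy: "{x, y} \<in> crossed n ?P c" for x y
    proof -
      obtain d where d: "d \<in> grid n" "d \<prec> c" "?P d = Cross"
        "{x, y} = {left_pipe n ?P d, bottom_pipe n ?P d}"
        using xy unfolding crossed_def by blast
      then have "min x y = min (left_pipe n ?P d) (bottom_pipe n ?P d)"
        unfolding doubleton_eq_iff by (elim disjE conjE) (simp_all add: min.commute)
      then show ?thesis using low[OF d(1-3)] by simp
    qed
    have "min ?p ?q \<in> ?V" if X: "?P c = Cross"
    proof -
      note cross = pipe_dream_cross[OF P cg, folded cij, OF X]
      have ij: "i + j \<le> n" using tile X by (auto split: if_splits)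
      have "M c = HTile \<or> M c = Cross \<or> M c = MarkedRTile" using tile X by (auto split: if_splits)
      then show ?thesis
      proof (elim disjE)
        assume "M c = HTile"
        \<comment> \<open>If the invisible pipe were the smaller one, the pair would already have crossed, at an
          earlier cell whose smaller pipe is visible.\<close>
        then have "?p \<in> ?V" "?q \<notin> ?V" using L B by (auto simp: edge_simps)
        then show ?thesis using cross(4) low_crossed[of ?p ?q] by (cases "?q < ?p") (auto simp: min_def)
      next
        assume "M c = Cross"
        then have "?p \<in> ?V" "?q \<in> ?V" using L B by (auto simp: edge_simps)
        then show ?thesis by (simp add: min_def)
      next
        assume mark: "M c = MarkedRTile"
        then have vis: "?p \<notin> ?V" "?q \<in> ?V" using L B by (auto simp: edge_simps)
        have "\<exists>(i', j')\<in>grid n. i' > i \<and> M (i', j') = HTile \<and>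
            left_pipe n M (i', j') = bottom_pipe n M (i, j)"
          using bspec[OF conjunct2[OF M[unfolded is_MVPD_def]] cg] mark unfolding cij by simp
        then obtain i' j' where d: "(i', j') \<in> grid n" "i < i'" "M (i', j') = HTile"
          "left_pipe n M (i', j') = bottom_pipe n M (i, j)" by auto
        define d where "d = (i', j')"
        have dc: "d \<in> grid n" "d \<prec> c" using d cij unfolding d_def by (auto simp: precedes_def)
        note seen = before[OF dc]
        \<comment> \<open>The invisible pipe that the marked pipe crosses at the H-tile.\<close>
        define r where "r = bottom_pipe n ?P d"
        have Xd: "?P d = Cross" and visd: "left_pipe n ?P d \<in> ?V" "r \<notin> ?V"
        proof -
          have "hide (?P d) (left_pipe n ?P d \<in> ?V) (r \<in> ?V) = HTile"
            using seen d(3) unfolding hidden_def d_def r_def by simp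
          moreover have "?P d \<noteq> HTile" unfolding d_def reveal_def by simp
          ultimately show "?P d = Cross" "left_pipe n ?P d \<in> ?V" "r \<notin> ?V"
            by (cases "?P d"; auto split: if_splits)+
        qed
        have q: "left_pipe n ?P d = ?q"
        proof -
          have "mask ?V (left_pipe n ?P d) = mask ?V ?q"
            using seen here d(4) unfolding masked_def d_def cij by simp
          then show ?thesis using visd vis by (simp add: mask_def)
        qed
        have qr: "{?q, r} \<in> crossed n ?P c"
        proof -
          have "{left_pipe n ?P d, bottom_pipe n ?P d} \<in> crossed n ?P c"
            using dc Xd unfolding crossed_def by blast
          then show ?thesis unfolding q r_def .
        qed
        have less: "?q < r"
        proof -
          have "min ?q r \<in> ?V" using low[OF dc Xd] unfolding q r_def .
          moreover have "?q \<noteq> r"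
            using pipe_dream_cross(3)[OF P dc(1)[unfolded d_def] Xd[unfolded d_def]] q
            unfolding r_def d_def by simp
          ultimately show ?thesis using visd(2) by (cases "?q < r") (simp_all add: min_def)
        qed
        let ?a = "word n ?P i j"
        have st: "inversion_state ?a (crossed n ?P c) (Suc n - i) {i..n}"
          unfolding cij using pipe_dream_state[OF P, of i j, THEN conjunct1] cg by (simp add: grid_def)
        have "r \<in> {i..n}" using inversion_stateD(2)[OF st qr] by blast
        then have "r \<in> ?a ` {1..Suc n - i}"
          unfolding bij_betw_imp_surj_on[OF inversion_stateD(1)[OF st]] .
        then obtain k where k: "k \<in> {1..Suc n - i}" and r: "r = ?a k" by blast
        have pq: "?p = ?a j" "?q = ?a (Suc j)" unfolding cij word_at_cell by simp_all
        \<comment> \<open>The pair \<open>r\<close> and \<open>?q\<close> is inverted, so \<open>r\<close> is at or to the left of the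
          invisible pipe \<open>?p\<close>; two invisible pipes have not crossed, so \<open>r\<close> is at most \<open>?p\<close>.\<close>
        have "k \<noteq> Suc j" using less r pq(2) by auto
        moreover have "\<not> Suc j < k"
        proof
          assume "Suc j < k"
          then have "{?a (Suc j), ?a k} \<in> crossed n ?P c \<longleftrightarrow> ?a k < ?a (Suc j)"
            using k by (intro inversion_stateD(3)[OF st]) simp_all
          then show False using qr less unfolding pq(2) r by linarith
        qed
        ultimately have "k = j \<or> k < j" by linarith
        then have "?q < ?p"
        proof
          assume "k = j"
          then show ?thesis using less r pq(1) by simp
        next
          assume kj: "k < j"
          have "k \<noteq> j" "j \<in> {1..Suc n - i}" using kj ij k by simp_all
          then have "r \<noteq> ?p"
            using inj_on_eq_iff[OF bij_betw_imp_inj_on[OF inversion_stateD(1)[OF st]]] k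
            unfolding pq(1) r by blast
          moreover have "\<not> ?p < r"
          proof
            assume pr: "?p < r"
            have "{?a k, ?a j} \<in> crossed n ?P c \<longleftrightarrow> ?a j < ?a k"
              using k kj ij by (intro inversion_stateD(3)[OF st]) simp_all
            then have "{r, ?p} \<in> crossed n ?P c" using pr unfolding pq(1) r by blast
            from low_crossed[OF this] show False using pr vis by (simp add: min_def)
          qed
          ultimately show ?thesis using less by linarith
        qed
        then show ?thesis using vis by (simp add: min_def)
      qed
    qed
    then show "hidden n ?V ?P M c" unfolding hidden_def using hide by blast
  qed
qed


section \<open>The bijection\<close>

lemma lower_visible_crossed:
  assumes "lower_visible n V P" "{x, y} \<in> crossed n P c"
  shows "min x y \<in> V"
proof -
  obtain d where d: "d \<in> grid n" "P d = Cross" "{x, y} = {left_pipe n P d, bottom_pipe n P d}"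
    using assms(2) unfolding crossed_def by blast
  then have "min x y = min (left_pipe n P d) (bottom_pipe n P d)"
    unfolding doubleton_eq_iff by (elim disjE conjE) (simp_all add: min.commute)
  then show ?thesis using assms(1) d(1,2) unfolding lower_visible_def by simp
qed

lemma lr_maxima_iff:
  assumes "inj_on u {1..n}" "k \<in> {1..n}"
  shows "u k \<in> lr_maxima n u \<longleftrightarrow> (\<forall>j\<in>{1..<k}. u j < u k)"
proof
  assume "u k \<in> lr_maxima n u"
  then obtain i where "u k = u i" "i \<in> {1..n}" "\<forall>j\<in>{1..<i}. u j < u i"
    unfolding lr_maxima_def by blast
  moreover from this have "k = i" using assms inj_on_eq_iff by metis
  ultimately show "\<forall>j\<in>{1..<k}. u j < u k" by simp
next
  assume "\<forall>j\<in>{1..<k}. u j < u k"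
  then show "u k \<in> lr_maxima n u" using assms(2) unfolding lr_maxima_def by blast
qed

text \<open>The values with a larger one somewhere to their left; these are the nonzero entries of \<open>\<alpha>'\<close>.\<close>

definition covered :: "nat \<Rightarrow> (nat \<Rightarrow> nat) \<Rightarrow> nat set" where
  "covered n u = {1..n} - lr_maxima n u"

text \<open>Crossings are never undone, so two pipes that share a cross tile exit in decreasing order,
  and the smaller one is preceded by the larger one.\<close>

lemma covered_lower_visible:
  assumes P: "is_pipe_dream n P" and exits: "\<And>k. k \<in> {1..n} \<Longrightarrow> exit_pipe n P k = u k"
  shows "lower_visible n (covered n u) P"
  unfolding lower_visible_def
proof (intro ballI impI)
  fix c assume c: "c \<in> grid n" and X: "P c = Cross"
  obtain i j where cij: "c = (i, j)" by fastforce
  let ?p = "left_pipe n P c" and ?q = "bottom_pipe n P c"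
  note st = pipe_dream_exits[OF P]
  have bij: "bij_betw u {1..n} {1..n}"
    using inversion_stateD(1)[OF st] exits bij_betw_cong[of "{1..n}" "exit_pipe n P" u] by simp
  have st: "inversion_state u (crossed n P (1, Suc n)) n {1..n}"
    by (rule inversion_state_cong[OF st]) (simp add: exits)
  have "c \<prec> (1, Suc n)" using c by (auto simp: grid_def precedes_def)
  then have pq: "{?p, ?q} \<in> crossed n P (1, Suc n)" using c X unfolding crossed_def by blast
  then have range: "?p \<in> {1..n}" "?q \<in> {1..n}" using inversion_stateD(2)[OF st pq] by auto
  have ne: "?p \<noteq> ?q" using pipe_dream_cross(3)[OF P c[unfolded cij] X[unfolded cij]] cij by simp
  have low: "min x y \<in> covered n u" if xy: "{x, y} \<in> crossed n P (1, Suc n)" "x < y"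
    "x \<in> {1..n}" "y \<in> {1..n}" for x y
  proof -
    obtain k l where k: "k \<in> {1..n}" "u k = x" and l: "l \<in> {1..n}" "u l = y"
      using xy(3,4) bij_betw_imp_surj_on[OF bij] by (metis imageE)
    have "\<not> k < l"
    proof
      assume "k < l"
      then have "{u k, u l} \<in> crossed n P (1, Suc n) \<longleftrightarrow> u l < u k"
        using k l by (intro inversion_stateD(3)[OF st]) simp_all
      then show False using xy k l by simp
    qed
    then have "l \<in> {1..<k}" using k l xy(2) by (cases "k = l") auto
    then have "x \<notin> lr_maxima n u"
      using lr_maxima_iff[OF bij_betw_imp_inj_on[OF bij] k(1)] k l xy(2) less_asym by blast
    then show ?thesis using xy(2,3) unfolding covered_def by (simp add: min_def)
  qed
  show "min ?p ?q \<in> covered n u"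
  proof (cases "?p < ?q")
    case True
    then show ?thesis using low[OF pq] range by blast
  next
    case False
    then show ?thesis using low[of ?q ?p] pq range ne by (simp add: insert_commute min.commute)
  qed
qed

text \<open>A word is determined by its visible entries and their positions if the remaining values
  are arranged in increasing order: at the first difference, the smaller of the two entries would have
  to occur later in the other word, after a larger one.\<close>

lemma increasing_filling_unique:
  fixes f g :: "nat \<Rightarrow> nat"
  assumes f: "bij_betw f {1..n} S" and g: "bij_betw g {1..n} S"
    and mask: "\<And>k. k \<in> {1..n} \<Longrightarrow> mask V (f k) = mask V (g k)" and V: "0 \<notin> V"
    and incf: "\<And>k l. k \<in> {1..n} \<Longrightarrow> l \<in> {1..n} \<Longrightarrow> k < l \<Longrightarrow> f k \<notin> V \<Longrightarrow> f l \<notin> V \<Longrightarrow> f k < f l"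
    and incg: "\<And>k l. k \<in> {1..n} \<Longrightarrow> l \<in> {1..n} \<Longrightarrow> k < l \<Longrightarrow> g k \<notin> V \<Longrightarrow> g l \<notin> V \<Longrightarrow> g k < g l"
    and k: "k \<in> {1..n}"
  shows "f k = g k"
  using k
proof (induction k rule: less_induct)
  case (less k)
  have no_less: False
    if bij: "bij_betw a {1..n} S" "bij_betw b {1..n} S"
      and inc: "\<And>k l. k \<in> {1..n} \<Longrightarrow> l \<in> {1..n} \<Longrightarrow> k < l \<Longrightarrow> b k \<notin> V \<Longrightarrow> b l \<notin> V \<Longrightarrow> b k < b l"
      and eq: "\<And>l. l < k \<Longrightarrow> l \<in> {1..n} \<Longrightarrow> a l = b l"
      and out: "a k \<notin> V" "b k \<notin> V" and lt: "a k < b k" for a b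
  proof -
    have "a k \<in> S" using bij_betwE[OF bij(1)] less.prems by blast
    then obtain l where l: "l \<in> {1..n}" "a k = b l"
      using bij_betw_imp_surj_on[OF bij(2)] by (metis imageE)
    have "\<not> k < l" using inc[OF less.prems l(1)] out l(2) lt by auto
    moreover have "l \<noteq> k" using l(2) lt by auto
    ultimately have "l < k" by linarith
    then have "a l = a k" using eq l by simp
    then have "l = k" using inj_on_eq_iff[OF bij_betw_imp_inj_on[OF bij(1)] l(1) less.prems] by simp
    then show False using \<open>l < k\<close> by simp
  qed
  have mk: "mask V (f k) = mask V (g k)" by (rule mask[OF less.prems])
  show ?case
  proof (cases "f k \<in> V")
    case True
    then have "mask V (g k) \<noteq> 0" using mk mask_nonzero[OF V] by metis
    then have "g k \<in> V" using mask_nonzero[OF V] by blast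
    then show ?thesis using True mk by (simp add: mask_def)
  next
    case False
    then have gk: "g k \<notin> V" using mk mask_nonzero[OF V] by metis
    have "\<not> f k < g k"
    proof
      assume lt: "f k < g k"
      show False by (rule no_less[OF f g _ _ False gk lt]) (use incg less.IH in blast)+
    qed
    moreover have "\<not> g k < f k"
    proof
      assume lt: "g k < f k"
      show False by (rule no_less[OF g f _ _ gk False lt]) (use incf less.IH in \<open>simp; blast\<close>)+
    qed
    ultimately show ?thesis by linarith
  qed
qed

lemma alpha'_eq_mask:
  assumes "inv w permutes {1..n}" "k \<in> {1..n}"
  shows "alpha' n w k = mask (covered n (inv w)) (inv w k)"
  using permutes_in_image[OF assms(1), of k] assms(2)
  unfolding alpha'_def mask_def covered_def by auto

lemma hide_pipes_weight:
  assumes P: "is_pipe_dream n P" and low: "lower_visible n V P" and c: "c \<in> grid n"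
  shows "hide_pipes n V P c \<in> {HTile, Cross, MarkedRTile} \<longleftrightarrow> P c = Cross"
proof -
  obtain i j where cij: "c = (i, j)" by fastforce
  have tile: "P c = Bump \<or> P c = Cross \<or> P c = JTile \<or> P c = Blank"
    using pipe_dream_tile[OF P c[unfolded cij]] unfolding cij
    by (cases "i + j \<le> n"; cases "i + j = n + 1") auto
  have "left_pipe n P c \<in> V \<or> bottom_pipe n P c \<in> V" if "P c = Cross"
  proof -
    have "min (left_pipe n P c) (bottom_pipe n P c) \<in> V"
      using low c that unfolding lower_visible_def by blast
    then show ?thesis by (auto simp: min_def split: if_splits)
  qed
  then show ?thesis
    using tile c unfolding hide_pipes_def by (elim disjE) auto
qed

lemma reveal_hide_pipes:
  assumes P: "is_pipe_dream n P" and low: "lower_visible n V P"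
  shows "reveal n (hide_pipes n V P) = P"
proof
  fix c :: cell
  obtain i j where cij: "c = (i, j)" by fastforce
  show "reveal n (hide_pipes n V P) c = P c"
  proof (cases "c \<in> grid n")
    case True
    then show ?thesis
      using pipe_dream_tile[OF P True[unfolded cij]] hide_pipes_weight[OF P low True]
      unfolding cij reveal_def
      by (cases "i + j \<le> n"; cases "i + j = n + 1") auto
  next
    case False
    then have "P c = Blank" using tiling_outside[of n P c] P unfolding is_pipe_dream_def by blast
    then show ?thesis using False unfolding cij reveal_def by simp
  qed
qed

lemma hide_pipes_in_MVPD:
  assumes w: "w permutes {1..n}" and P: "P \<in> PD n w"
  defines "V \<equiv> covered n (inv w)"
  shows "hide_pipes n V P \<in> MVPD n w" "lower_visible n V P"
proof -
  have dream: "is_pipe_dream n P" and exits: "\<And>k. k \<in> {1..n} \<Longrightarrow> exit_pipe n P k = inv w k"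
    using P unfolding PD_def by auto
  have V: "0 \<notin> V" by (simp add: V_def covered_def)
  show low: "lower_visible n V P"
    unfolding V_def by (rule covered_lower_visible[OF dream exits])
  have "exit_pipe n (hide_pipes n V P) k = alpha' n w k" if k: "k \<in> {1..n}" for k
    using exit_pipe_masked[OF dream V k hide_pipes_masked[OF dream V low]]
      alpha'_eq_mask[OF permutes_inv[OF w] k] exits[OF k] unfolding V_def by simp
  then show "hide_pipes n V P \<in> MVPD n w"
    unfolding MVPD_def using hide_pipes_MVPD[OF dream V low] by blast
qed

text \<open>The pipes entering \<open>M\<close> are the nonzero entries of its code, so they are the covered values. In both
  words the invisible pipes exit in increasing order: in the revealed pipe dream because an inversion
  would be a crossing of two invisible pipes, in \<open>w\<inverse>\<close> because they are left-to-right maxima.\<close>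

lemma reveal_in_PD:
  assumes w: "w permutes {1..n}" and M: "M \<in> MVPD n w"
  shows "reveal n M \<in> PD n w" "hide_pipes n (covered n (inv w)) (reveal n M) = M"
proof -
  let ?P = "reveal n M" and ?E = "entering n M" and ?u = "inv w"
  have mvpd: "is_MVPD n M" and code: "\<And>k. k \<in> {1..n} \<Longrightarrow> exit_pipe n M k = alpha' n w k"
    using M unfolding MVPD_def by auto
  note P = reveal_pipe_dream[of n M] and seen = reveal_masked[OF mvpd]
  have E: "0 \<notin> ?E" by (simp add: entering_def)
  have u: "?u permutes {1..n}" by (rule permutes_inv[OF w])
  have bij_u: "bij_betw ?u {1..n} {1..n}" by (rule permutes_imp_bij[OF u])
  note st = pipe_dream_exits[OF P]
  note bij_e = inversion_stateD(1)[OF st]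
  have mask_eq: "mask ?E (exit_pipe n ?P k) = mask (covered n ?u) (?u k)" if k: "k \<in> {1..n}" for k
    using exit_pipe_masked[OF P E k seen] code[OF k] alpha'_eq_mask[OF u k] by simp
  have C: "0 \<notin> covered n ?u" by (simp add: covered_def)
  have EC: "?E = covered n ?u"
  proof (intro set_eqI iffI)
    fix r assume r: "r \<in> ?E"
    then have "r \<in> {1..n}" by (simp add: entering_def)
    then obtain k where k: "k \<in> {1..n}" "exit_pipe n ?P k = r"
      using bij_betw_imp_surj_on[OF bij_e] by (metis imageE)
    then show "r \<in> covered n ?u"
      using mask_eq[OF k(1)] r E by (cases "?u k \<in> covered n ?u") (auto simp: mask_def)
  next
    fix r assume r: "r \<in> covered n ?u"
    then have "r \<in> {1..n}" by (simp add: covered_def)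
    then obtain k where k: "k \<in> {1..n}" "?u k = r"
      using bij_betw_imp_surj_on[OF bij_u] by (metis imageE)
    then show "r \<in> ?E"
      using mask_eq[OF k(1)] r C by (cases "exit_pipe n ?P k \<in> ?E") (auto simp: mask_def)
  qed
  have low: "lower_visible n ?E ?P"
    using seen unfolding lower_visible_def hidden_def by blast
  have "exit_pipe n ?P k = ?u k" if k: "k \<in> {1..n}" for k
  proof (rule increasing_filling_unique[OF bij_e bij_u _ E _ _ k])
    show "mask ?E (exit_pipe n ?P k) = mask ?E (?u k)" if "k \<in> {1..n}" for k
      using mask_eq[OF that] unfolding EC .
  next
    fix k l assume kl: "k \<in> {1..n}" "l \<in> {1..n}" "k < l"
      and out: "exit_pipe n ?P k \<notin> ?E" "exit_pipe n ?P l \<notin> ?E"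
    have "\<not> exit_pipe n ?P l < exit_pipe n ?P k"
    proof
      assume "exit_pipe n ?P l < exit_pipe n ?P k"
      then have "{exit_pipe n ?P k, exit_pipe n ?P l} \<in> crossed n ?P (1, Suc n)"
        using inversion_stateD(3)[OF st, of k l] kl by simp
      from lower_visible_crossed[OF low this] show False using out by (simp add: min_def split: if_splits)
    qed
    moreover have "exit_pipe n ?P k \<noteq> exit_pipe n ?P l"
      using inj_on_eq_iff[OF bij_betw_imp_inj_on[OF bij_e] kl(1,2)] kl(3) by simp
    ultimately show "exit_pipe n ?P k < exit_pipe n ?P l" by linarith
  next
    fix k l assume kl: "k \<in> {1..n}" "l \<in> {1..n}" "k < l" and out: "?u k \<notin> ?E" "?u l \<notin> ?E"
    have "?u l \<in> {1..n}" using bij_betwE[OF bij_u] kl(2) by blast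
    then have "?u l \<in> lr_maxima n ?u" using out(2) unfolding EC covered_def by blast
    then show "?u k < ?u l"
      using lr_maxima_iff[OF bij_betw_imp_inj_on[OF bij_u] kl(2)] kl by simp
  qed
  then show "?P \<in> PD n w" unfolding PD_def using P by blast
  have T: "is_tiling n (unmark \<circ> M)"
    using mvpd unfolding is_MVPD_def is_vertical_less_def by blast
  show "hide_pipes n (covered n ?u) ?P = M"
  proof
    fix c
    show "hide_pipes n (covered n ?u) ?P c = M c"
    proof (cases "c \<in> grid n")
      case True
      then show ?thesis using seen[OF True] unfolding hidden_def hide_pipes_def EC by simp
    next
      case False
      then show ?thesis using tiling_outside[OF T False] unfolding hide_pipes_def
        by (cases "M c") (auto simp: unmark.simps)
    qed
  qed
qed

text \<open>The weight enters only through the set of weight cells, so one bijection serves the single and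
  the double version at once.\<close>

lemma sum_PD_eq_sum_MVPD:
  assumes w: "w permutes {1..n}"
  shows "(\<Sum>P\<in>PD n w. h (wty_PD n P)) = (\<Sum>M\<in>MVPD n w. h (wty_MVPD n M))"
proof (rule sum.reindex_bij_witness[of _ "reveal n" "hide_pipes n (covered n (inv w))"])
  fix P assume P: "P \<in> PD n w"
  then have dream: "is_pipe_dream n P" by (simp add: PD_def)
  note low = hide_pipes_in_MVPD(2)[OF w P]
  show "reveal n (hide_pipes n (covered n (inv w)) P) = P"
    by (rule reveal_hide_pipes[OF dream low])
  show "hide_pipes n (covered n (inv w)) P \<in> MVPD n w"
    by (rule hide_pipes_in_MVPD(1)[OF w P])
  have "wty_MVPD n (hide_pipes n (covered n (inv w)) P) = wty_PD n P"
    unfolding wty_MVPD_def wty_PD_def using hide_pipes_weight[OF dream low] by blast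
  then show "h (wty_MVPD n (hide_pipes n (covered n (inv w)) P)) = h (wty_PD n P)" by simp
next
  fix M assume M: "M \<in> MVPD n w"
  show "hide_pipes n (covered n (inv w)) (reveal n M) = M" by (rule reveal_in_PD(2)[OF w M])
  show "reveal n M \<in> PD n w" by (rule reveal_in_PD(1)[OF w M])
qed

theorem corollary3p7:
  fixes n :: nat and w :: "nat \<Rightarrow> nat"
  assumes "n \<ge> 1" and "w permutes {1..n}"
  shows "groth n w = (\<Sum>M\<in>MVPD n w.
           neg_one_pow (int (card (wty_MVPD n M)) - int (perm_length n w)) * wt_x (wty_MVPD n M))
       \<and> double_groth n w = (\<Sum>M\<in>MVPD n w.
           neg_one_pow (int (card (wty_MVPD n M)) - int (perm_length n w)) * wt_xy (wty_MVPD n M))"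
  unfolding groth_def double_groth_def
  using sum_PD_eq_sum_MVPD[OF assms(2), of "\<lambda>D. neg_one_pow (int (card D) - int (perm_length n w)) * wt_x D"]
    sum_PD_eq_sum_MVPD[OF assms(2), of "\<lambda>D. neg_one_pow (int (card D) - int (perm_length n w)) * wt_xy D"]
  by (rule conjI)

end
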